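(* For each $(\mathsf{J},\mathsf{SM})$-stable class $K$ of Boolean functions (there are exactly 93 of them, namely the classes $K$ occurring in the list below) there exist clones $C_1^K$ and $C_2^K$, as prescribed in the list, such that for every clone $C$ of Boolean functions: $KC\subseteq K$ if and only if $C\subseteq C_1^K$, and $CK\subseteq K$ if and only if $C\subseteq C_2^K$. The list, where an entry $K: (C_1^K; C_2^K)$ gives the two clones for $K$: $\mathsf{\Omega}: (\mathsf{\Omega};\mathsf{\Omega})$. $\mathsf{\Omega}_{\leq}: (\mathsf{\Omega}_{01};\mathsf{M})$. $\mathsf{\Omega}_{\geq}: (\mathsf{\Omega}_{01};\mathsf{M})$. $\mathsf{\Omega}_{\neq,00}: (\mathsf{\Omega}_{01};\mathsf{U}^2)$. $\mathsf{\Omega}_{\neq,11}: (\mathsf{\Omega}_{01};\mathsf{W}^2)$. $\mathsf{\Omega}_{=}: (\mathsf{\Omega}_{01};\mathsf{\Omega})$. $\mathsf{\Omega}_{\neq}: (\mathsf{\Omega}_{01};\mathsf{S})$. $\mathsf{\Omega}_{0*}\cup\mathsf{C}: (\mathsf{\Omega}_{0*};\mathsf{M})$. $\mathsf{\Omega}_{1*}\cup\mathsf{C}: (\mathsf{\Omega}_{0*};\mathsf{M})$. $\mathsf{\Omega}_{*0}\cup\mathsf{C}: (\mathsf{\Omega}_{*1};\mathsf{M})$. $\mathsf{\Omega}_{*1}\cup\mathsf{C}: (\mathsf{\Omega}_{*1};\mathsf{M})$. $\mathsf{\Omega}_{0*}: (\mathsf{\Omega}_{0*};\mathsf{\Omega}_{0*})$.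 $\mathsf{\Omega}_{1*}: (\mathsf{\Omega}_{0*};\mathsf{\Omega}_{*1})$. $\mathsf{\Omega}_{*0}: (\mathsf{\Omega}_{*1};\mathsf{\Omega}_{0*})$. $\mathsf{\Omega}_{*1}: (\mathsf{\Omega}_{*1};\mathsf{\Omega}_{*1})$. $\mathsf{\Omega}_{00}\cup\mathsf{C}: (\mathsf{\Omega}_{01};\mathsf{M})$. $\mathsf{\Omega}_{11}\cup\mathsf{C}: (\mathsf{\Omega}_{01};\mathsf{M})$. $\mathsf{\Omega}_{00}: (\mathsf{\Omega}_{01};\mathsf{\Omega}_{0*})$. $\mathsf{\Omega}_{11}: (\mathsf{\Omega}_{01};\mathsf{\Omega}_{*1})$. $\mathsf{\Omega}_{01}\cup\mathsf{C}: (\mathsf{\Omega}_{01};\mathsf{M})$. $\mathsf{\Omega}_{10}\cup\mathsf{C}: (\mathsf{\Omega}_{01};\mathsf{M})$. $\mathsf{\Omega}_{01}\cup\mathsf{C}_0: (\mathsf{\Omega}_{01};\mathsf{M}_{0*})$. $\mathsf{\Omega}_{10}\cup\mathsf{C}_1: (\mathsf{\Omega}_{01};\mathsf{M}_{*1})$. $\mathsf{\Omega}_{01}\cup\mathsf{C}_1: (\mathsf{\Omega}_{01};\mathsf{M}_{*1})$. $\mathsf{\Omega}_{10}\cup\mathsf{C}_0: (\mathsf{\Omega}_{01};\mathsf{M}_{0*})$. $\mathsf{\Omega}_{01}: (\mathsf{\Omega}_{01};\mathsf{\Omega}_{01})$. $\mathsf{\Omega}_{10}: (\mathsf{\Omega}_{01};\mathsf{\Omega}_{01})$.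 $\mathsf{S}^-: (\mathsf{S};\mathsf{U}^2)$. $\mathsf{S}^+: (\mathsf{S};\mathsf{W}^2)$. $\mathsf{S}^-_{\neq}: (\mathsf{S}_{01};\mathsf{SM})$. $\mathsf{S}^+_{\neq}: (\mathsf{S}_{01};\mathsf{SM})$. $\mathsf{S}^-_{0*}: (\mathsf{S}_{01};\mathsf{U}^2)$. $\mathsf{S}^+_{1*}: (\mathsf{S}_{01};\mathsf{W}^2)$. $\mathsf{S}^-_{*0}: (\mathsf{S}_{01};\mathsf{U}^2)$. $\mathsf{S}^+_{*1}: (\mathsf{S}_{01};\mathsf{W}^2)$. $\mathsf{S}^-_{01}\cup\mathsf{C}_0: (\mathsf{S}_{01};\mathsf{MU}^2)$. $\mathsf{S}^+_{10}\cup\mathsf{C}_1: (\mathsf{S}_{01};\mathsf{MW}^2)$. $\mathsf{S}^-_{10}\cup\mathsf{C}_0: (\mathsf{S}_{01};\mathsf{MU}^2)$. $\mathsf{S}^+_{01}\cup\mathsf{C}_1: (\mathsf{S}_{01};\mathsf{MW}^2)$. $\mathsf{S}^-_{01}: (\mathsf{S}_{01};\mathsf{U}^2_{01})$. $\mathsf{S}^+_{10}: (\mathsf{S}_{01};\mathsf{W}^2_{01})$. $\mathsf{S}^-_{10}: (\mathsf{S}_{01};\mathsf{U}^2_{01})$. $\mathsf{S}^+_{01}: (\mathsf{S}_{01};\mathsf{W}^2_{01})$. $\mathsf{S}^-_{00}: (\mathsf{S}_{01};\mathsf{U}^2)$. $\mathsf{S}^+_{11}: (\mathsf{S}_{01};\mathsf{W}^2)$.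 $\mathsf{S}: (\mathsf{S};\mathsf{S})$. $\mathsf{S}_{01}: (\mathsf{S}_{01};\mathsf{S}_{01})$. $\mathsf{S}_{10}: (\mathsf{S}_{01};\mathsf{S}_{01})$. $\mathsf{M}: (\mathsf{M};\mathsf{M})$. $\overline{\mathsf{M}}: (\mathsf{M};\mathsf{M})$. $\mathsf{M}_{0*}: (\mathsf{M}_{0*};\mathsf{M}_{0*})$. $\overline{\mathsf{M}}_{1*}: (\mathsf{M}_{0*};\mathsf{M}_{*1})$. $\mathsf{M}_{*1}: (\mathsf{M}_{*1};\mathsf{M}_{*1})$. $\overline{\mathsf{M}}_{*0}: (\mathsf{M}_{*1};\mathsf{M}_{0*})$. $\mathsf{M}_{01}: (\mathsf{M}_{01};\mathsf{M}_{01})$. $\overline{\mathsf{M}}_{10}: (\mathsf{M}_{01};\mathsf{M}_{01})$. $\mathsf{SM}: (\mathsf{SM};\mathsf{SM})$. $\overline{\mathsf{SM}}: (\mathsf{SM};\mathsf{SM})$. $\mathsf{U}^2: (\mathsf{U}^2;\mathsf{U}^2)$. $\overline{\mathsf{U}^2}: (\mathsf{U}^2;\mathsf{W}^2)$. $\mathsf{U}^2_{01}\cup\mathsf{C}_0: (\mathsf{U}^2_{01};\mathsf{MU}^2)$. $\overline{\mathsf{U}^2}_{10}\cup\mathsf{C}_1: (\mathsf{U}^2_{01};\mathsf{MW}^2)$. $\mathsf{U}^2_{01}: (\mathsf{U}^2_{01};\mathsf{U}^2_{01})$. $\overline{\mathsf{U}^2}_{10}: (\mathsf{U}^2_{01};\mathsf{W}^2_{01})$.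 $\mathsf{MU}^2: (\mathsf{MU}^2;\mathsf{MU}^2)$. $\overline{\mathsf{MU}^2}: (\mathsf{MU}^2;\mathsf{MW}^2)$. $\mathsf{MU}^2_{01}: (\mathsf{MU}^2_{01};\mathsf{MU}^2_{01})$. $\overline{\mathsf{MU}^2}_{10}: (\mathsf{MU}^2_{01};\mathsf{MW}^2_{01})$. $\mathsf{W}^2: (\mathsf{W}^2;\mathsf{W}^2)$. $\overline{\mathsf{W}^2}: (\mathsf{W}^2;\mathsf{U}^2)$. $\mathsf{W}^2_{01}\cup\mathsf{C}_1: (\mathsf{W}^2_{01};\mathsf{MW}^2)$. $\overline{\mathsf{W}^2}_{10}\cup\mathsf{C}_0: (\mathsf{W}^2_{01};\mathsf{MU}^2)$. $\mathsf{W}^2_{01}: (\mathsf{W}^2_{01};\mathsf{W}^2_{01})$. $\overline{\mathsf{W}^2}_{10}: (\mathsf{W}^2_{01};\mathsf{U}^2_{01})$. $\mathsf{MW}^2: (\mathsf{MW}^2;\mathsf{MW}^2)$. $\overline{\mathsf{MW}^2}: (\mathsf{MW}^2;\mathsf{MU}^2)$. $\mathsf{MW}^2_{01}: (\mathsf{MW}^2_{01};\mathsf{MW}^2_{01})$. $\overline{\mathsf{MW}^2}_{10}: (\mathsf{MW}^2_{01};\mathsf{MU}^2_{01})$. $\mathsf{U}^2_{00}: (\mathsf{U}^2_{01};\mathsf{U}^2)$. $\overline{\mathsf{U}^2}_{11}: (\mathsf{U}^2_{01};\mathsf{W}^2)$. $\mathsf{W}^2_{11}: (\mathsf{W}^2_{01};\mathsf{W}^2)$.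 $\overline{\mathsf{W}^2}_{00}: (\mathsf{W}^2_{01};\mathsf{U}^2)$. $\mathsf{U}^2\cap\overline{\mathsf{W}^2}: (\mathsf{SM};\mathsf{U}^2)$. $\mathsf{W}^2\cap\overline{\mathsf{U}^2}: (\mathsf{SM};\mathsf{W}^2)$. $\mathsf{R}: (\mathsf{S};\mathsf{\Omega})$. $\mathsf{R}_{00}\cup\mathsf{C}: (\mathsf{S}_{01};\mathsf{M})$. $\mathsf{R}_{11}\cup\mathsf{C}: (\mathsf{S}_{01};\mathsf{M})$. $\mathsf{R}_{00}: (\mathsf{S}_{01};\mathsf{\Omega}_{0*})$. $\mathsf{R}_{11}: (\mathsf{S}_{01};\mathsf{\Omega}_{*1})$. $\mathsf{C}: (\mathsf{\Omega};\mathsf{\Omega})$. $\mathsf{C}_0: (\mathsf{\Omega};\mathsf{\Omega}_{0*})$. $\mathsf{C}_1: (\mathsf{\Omega};\mathsf{\Omega}_{*1})$. $\emptyset: (\mathsf{\Omega};\mathsf{\Omega})$.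
   Context: A Boolean function is a map $f\colon\{0,1\}^n\to\{0,1\}$ with $n\ge 1$; $\mathsf{\Omega}$ is the class of all Boolean functions (of all arities). The set $\{0,1\}^n$ is ordered componentwise, $\mathbf 0,\mathbf 1$ are the constant tuples, $\overline{\mathbf a}$ is the componentwise complement of $\mathbf a$, and $\wedge,\vee$ act componentwise on tuples. Composition and stability. For classes $I,J\subseteq\mathsf{\Omega}$, $IJ=\{f(g_1,\dots,g_n): f\in I \text{ is } n\text{-ary},\ g_1,\dots,g_n\in J \text{ all of the same arity } m\}$, where $f(g_1,\dots,g_n)(\mathbf a)=f(g_1(\mathbf a),\dots,g_n(\mathbf a))$. A clone (of Boolean functions) is a class $C\subseteq\mathsf{\Omega}$ containing all projections with $CC\subseteq C$. $\mathsf{J}$ is the clone of all projections. A class $K$ is $(C_1,C_2)$-stable, for clones $C_1,C_2$, if $KC_1\subseteq K$ and $C_2K\subseteq K$. Subclasses. For $C\subseteq\mathsf{\Omega}$ and $a,b\in\{0,1\}$: $C_{a*}=\{f\in C: f(\mathbf 0)=a\}$, $C_{*b}=\{f\in C: f(\mathbf 1)=b\}$, $C_{ab}=C_{a*}\cap C_{*b}$, $C_{=}=\{f\in C: f(\mathbf 0)=f(\mathbf 1)\}$, $C_{\neq}=\{f\in C: f(\mathbf 0)\neq f(\mathbf 1)\}$, $C_{\leq}=\{f\in C: f(\mathbf 0)\leq f(\mathbf 1)\}$, $C_{\geq}=\{f\in C: f(\mathbf 0)\geq f(\mathbf 1)\}$, $C_{\neq,00}=C_{\neq}\cup C_{00}$,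 $C_{\neq,11}=C_{\neq}\cup C_{11}$. The negation of $f$ is $\overline f(\mathbf a)=1-f(\mathbf a)$, and $\overline C=\{\overline f: f\in C\}$; a subscript on $\overline C$ is applied to the class $\overline C$ (e.g. $\overline{\mathsf M}_{1*}=\{f\in\overline{\mathsf M}: f(\mathbf 0)=1\}$). Named classes. $\mathsf{C}$: all constant functions; $\mathsf{C}_0,\mathsf{C}_1$: the constant functions with value $0$, resp. $1$. $\mathsf{M}$: monotone functions. $\mathsf{S}$: self-dual functions ($f(\overline{\mathbf a})=1-f(\mathbf a)$ for all $\mathbf a$); $\mathsf{SM}=\mathsf S\cap\mathsf M$. $\mathsf{R}$: reflexive functions ($f(\mathbf a)=f(\overline{\mathbf a})$ for all $\mathbf a$). $\mathsf{S}^-$ (resp. $\mathsf{S}^+$): functions $f$ that are pointwise $\le$ (resp. $\ge$) some self-dual function of the same arity; equivalently $f(\mathbf a)\wedge f(\overline{\mathbf a})=0$ (resp. $f(\mathbf a)\vee f(\overline{\mathbf a})=1$) for all $\mathbf a$. $\mathsf{U}^2$: functions such that $\mathbf a\wedge\mathbf b\neq\mathbf 0$ for all (not necessarily distinct) $\mathbf a,\mathbf b\in f^{-1}(1)$. $\mathsf{W}^2$: functions such that $\mathbf a\vee\mathbf b\neq\mathbf 1$ for all (not necessarily distinct) $\mathbf a,\mathbf b\in f^{-1}(0)$. $\mathsf{MU}^2=\mathsf M\cap\mathsf U^2$, $\mathsf{MW}^2=\mathsf M\cap\mathsf W^2$. *)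

theory Defs
  imports "HOL-Library.FuncSet"
begin

text \<open>
  The set \<open>{0,1}\<close> is \<^typ>\<open>bool\<close> with \<open>0 = False\<close> and \<open>1 = True\<close>, ordered by \<open>False \<le> True\<close>,
  and an \<open>n\<close>-tuple is a list of length \<open>n\<close>.  An \<open>n\<close>-ary function is the pair of its arity and a
  map on lists; the map is \<^const>\<open>extensional\<close> (i.e. \<open>undefined\<close> off \<open>cube n\<close>), so that equality of
  pairs is equality of Boolean functions.
\<close>

type_synonym bool_fun = "nat \<times> (bool list \<Rightarrow> bool)"

type_synonym bool_class = "bool_fun set"

abbreviation arity :: "bool_fun \<Rightarrow> nat" where
  "arity \<equiv> fst"

abbreviation val :: "bool_fun \<Rightarrow> bool list \<Rightarrow> bool" where
  "val \<equiv> snd"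

definition cube :: "nat \<Rightarrow> bool list set" where
  "cube n = {a. length a = n}"

abbreviation dom_of :: "bool_fun \<Rightarrow> bool list set" where
  "dom_of f \<equiv> cube (arity f)"

definition \<Omega> :: bool_class where
  "\<Omega> = {f. arity f \<ge> 1 \<and> val f \<in> extensional (dom_of f)}"

definition zeros :: "nat \<Rightarrow> bool list" where
  "zeros n = replicate n False"

definition ones :: "nat \<Rightarrow> bool list" where
  "ones n = replicate n True"

definition tuple_compl :: "bool list \<Rightarrow> bool list" where
  "tuple_compl a = map Not a"

definition meet :: "bool list \<Rightarrow> bool list \<Rightarrow> bool list" where
  "meet a b = map2 (\<and>) a b"

definition join :: "bool list \<Rightarrow> bool list \<Rightarrow> bool list" where
  "join a b = map2 (\<or>) a b"

definition tuple_le :: "bool list \<Rightarrow> bool list \<Rightarrow> bool" where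
  "tuple_le a b \<longleftrightarrow> list_all2 (\<le>) a b"

text \<open>
  \<open>fun_comp m f [g\<^sub>1, \<dots>, g\<^sub>n]\<close> is \<open>f(g\<^sub>1, \<dots>, g\<^sub>n)\<close> for inner functions of common arity \<open>m\<close>.  In \<open>I \<cdot> J\<close>
  with \<open>I \<subseteq> \<Omega>\<close> the list of inner functions is nonempty, so it determines \<open>m\<close>.
\<close>

definition fun_comp :: "nat \<Rightarrow> bool_fun \<Rightarrow> bool_fun list \<Rightarrow> bool_fun" where
  "fun_comp m f gs = (m, \<lambda>a\<in>cube m. val f (map (\<lambda>g. val g a) gs))"

definition class_comp :: "bool_class \<Rightarrow> bool_class \<Rightarrow> bool_class" (infixl "\<cdot>" 75) where
  "I \<cdot> J = {fun_comp m f gs | m f gs.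
      f \<in> I \<and> length gs = arity f \<and> set gs \<subseteq> J \<and> (\<forall>g\<in>set gs. arity g = m)}"

definition proj :: "nat \<Rightarrow> nat \<Rightarrow> bool_fun" where
  "proj n i = (n, \<lambda>a\<in>cube n. a ! i)"

definition \<J> :: bool_class where
  "\<J> = {proj n i | n i. i < n}"

definition clone :: "bool_class \<Rightarrow> bool" where
  "clone C \<longleftrightarrow> C \<subseteq> \<Omega> \<and> \<J> \<subseteq> C \<and> C \<cdot> C \<subseteq> C"

definition stable_class :: "bool_class \<Rightarrow> bool_class \<Rightarrow> bool_class \<Rightarrow> bool" where
  "stable_class C1 C2 K \<longleftrightarrow> K \<subseteq> \<Omega> \<and> K \<cdot> C1 \<subseteq> K \<and> C2 \<cdot> K \<subseteq> K"

definition at0 :: "bool_fun \<Rightarrow> bool" where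
  "at0 f = val f (zeros (arity f))"

definition at1 :: "bool_fun \<Rightarrow> bool" where
  "at1 f = val f (ones (arity f))"

definition sub_0any :: "bool_class \<Rightarrow> bool_class" ("_\<^bsub>0*\<^esub>" [1000] 1000) where
  "C\<^bsub>0*\<^esub> = {f \<in> C. at0 f = False}"

definition sub_1any :: "bool_class \<Rightarrow> bool_class" ("_\<^bsub>1*\<^esub>" [1000] 1000) where
  "C\<^bsub>1*\<^esub> = {f \<in> C. at0 f = True}"

definition sub_any0 :: "bool_class \<Rightarrow> bool_class" ("_\<^bsub>*0\<^esub>" [1000] 1000) where
  "C\<^bsub>*0\<^esub> = {f \<in> C. at1 f = False}"

definition sub_any1 :: "bool_class \<Rightarrow> bool_class" ("_\<^bsub>*1\<^esub>" [1000] 1000) where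
  "C\<^bsub>*1\<^esub> = {f \<in> C. at1 f = True}"

definition sub_00 :: "bool_class \<Rightarrow> bool_class" ("_\<^bsub>00\<^esub>" [1000] 1000) where
  "C\<^bsub>00\<^esub> = C\<^bsub>0*\<^esub> \<inter> C\<^bsub>*0\<^esub>"

definition sub_01 :: "bool_class \<Rightarrow> bool_class" ("_\<^bsub>01\<^esub>" [1000] 1000) where
  "C\<^bsub>01\<^esub> = C\<^bsub>0*\<^esub> \<inter> C\<^bsub>*1\<^esub>"

definition sub_10 :: "bool_class \<Rightarrow> bool_class" ("_\<^bsub>10\<^esub>" [1000] 1000) where
  "C\<^bsub>10\<^esub> = C\<^bsub>1*\<^esub> \<inter> C\<^bsub>*0\<^esub>"

definition sub_11 :: "bool_class \<Rightarrow> bool_class" ("_\<^bsub>11\<^esub>" [1000] 1000) where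
  "C\<^bsub>11\<^esub> = C\<^bsub>1*\<^esub> \<inter> C\<^bsub>*1\<^esub>"

definition sub_eq :: "bool_class \<Rightarrow> bool_class" ("_\<^bsub>=\<^esub>" [1000] 1000) where
  "C\<^bsub>=\<^esub> = {f \<in> C. at0 f = at1 f}"

definition sub_neq :: "bool_class \<Rightarrow> bool_class" ("_\<^bsub>\<noteq>\<^esub>" [1000] 1000) where
  "C\<^bsub>\<noteq>\<^esub> = {f \<in> C. at0 f \<noteq> at1 f}"

definition sub_le :: "bool_class \<Rightarrow> bool_class" ("_\<^bsub>\<le>\<^esub>" [1000] 1000) where
  "C\<^bsub>\<le>\<^esub> = {f \<in> C. at0 f \<le> at1 f}"

definition sub_ge :: "bool_class \<Rightarrow> bool_class" ("_\<^bsub>\<ge>\<^esub>" [1000] 1000) where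
  "C\<^bsub>\<ge>\<^esub> = {f \<in> C. at0 f \<ge> at1 f}"

definition sub_neq_00 :: "bool_class \<Rightarrow> bool_class" ("_\<^bsub>\<noteq>,00\<^esub>" [1000] 1000) where
  "C\<^bsub>\<noteq>,00\<^esub> = C\<^bsub>\<noteq>\<^esub> \<union> C\<^bsub>00\<^esub>"

definition sub_neq_11 :: "bool_class \<Rightarrow> bool_class" ("_\<^bsub>\<noteq>,11\<^esub>" [1000] 1000) where
  "C\<^bsub>\<noteq>,11\<^esub> = C\<^bsub>\<noteq>\<^esub> \<union> C\<^bsub>11\<^esub>"

definition neg_fun :: "bool_fun \<Rightarrow> bool_fun" where
  "neg_fun f = (arity f, \<lambda>a\<in>dom_of f. \<not> val f a)"

definition neg :: "bool_class \<Rightarrow> bool_class" where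
  "neg C = neg_fun ` C"

definition \<C> :: bool_class where
  "\<C> = {f \<in> \<Omega>. \<exists>c. \<forall>a\<in>dom_of f. val f a = c}"

definition \<C>0 :: bool_class where
  "\<C>0 = {f \<in> \<Omega>. \<forall>a\<in>dom_of f. val f a = False}"

definition \<C>1 :: bool_class where
  "\<C>1 = {f \<in> \<Omega>. \<forall>a\<in>dom_of f. val f a = True}"

definition \<M> :: bool_class where
  "\<M> = {f \<in> \<Omega>. \<forall>a\<in>dom_of f. \<forall>b\<in>dom_of f. tuple_le a b \<longrightarrow> val f a \<le> val f b}"

definition \<S> :: bool_class where
  "\<S> = {f \<in> \<Omega>. \<forall>a\<in>dom_of f. val f (tuple_compl a) = (\<not> val f a)}"

definition \<S>\<M> :: bool_class where
  "\<S>\<M> = \<S> \<inter> \<M>"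

definition \<R> :: bool_class where
  "\<R> = {f \<in> \<Omega>. \<forall>a\<in>dom_of f. val f a = val f (tuple_compl a)}"

definition Sminus :: bool_class ("\<S>\<^sup>-") where
  "\<S>\<^sup>- = {f \<in> \<Omega>. \<exists>g\<in>\<S>. arity g = arity f \<and> (\<forall>a\<in>dom_of f. val f a \<le> val g a)}"

definition Splus :: bool_class ("\<S>\<^sup>+") where
  "\<S>\<^sup>+ = {f \<in> \<Omega>. \<exists>g\<in>\<S>. arity g = arity f \<and> (\<forall>a\<in>dom_of f. val f a \<ge> val g a)}"

definition \<U>2 :: bool_class where
  "\<U>2 = {f \<in> \<Omega>. \<forall>a\<in>dom_of f. \<forall>b\<in>dom_of f.
            val f a \<and> val f b \<longrightarrow> meet a b \<noteq> zeros (arity f)}"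

definition \<W>2 :: bool_class where
  "\<W>2 = {f \<in> \<Omega>. \<forall>a\<in>dom_of f. \<forall>b\<in>dom_of f.
            \<not> val f a \<and> \<not> val f b \<longrightarrow> join a b \<noteq> ones (arity f)}"

definition \<M>\<U>2 :: bool_class where
  "\<M>\<U>2 = \<M> \<inter> \<U>2"

definition \<M>\<W>2 :: bool_class where
  "\<M>\<W>2 = \<M> \<inter> \<W>2"

text \<open>
  An entry \<open>(K, C1, C2)\<close> lists a class \<open>K\<close> together with the two clones \<open>C\<^sub>1\<^sup>K\<close> and \<open>C\<^sub>2\<^sup>K\<close>
  assigned to it.
\<close>

definition table :: "(bool_class \<times> bool_class \<times> bool_class) list" where
  "table = [
    (\<Omega>, \<Omega>, \<Omega>),
    (\<Omega>\<^bsub>\<le>\<^esub>, \<Omega>\<^bsub>01\<^esub>, \<M>),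
    (\<Omega>\<^bsub>\<ge>\<^esub>, \<Omega>\<^bsub>01\<^esub>, \<M>),
    (\<Omega>\<^bsub>\<noteq>,00\<^esub>, \<Omega>\<^bsub>01\<^esub>, \<U>2),
    (\<Omega>\<^bsub>\<noteq>,11\<^esub>, \<Omega>\<^bsub>01\<^esub>, \<W>2),
    (\<Omega>\<^bsub>=\<^esub>, \<Omega>\<^bsub>01\<^esub>, \<Omega>),
    (\<Omega>\<^bsub>\<noteq>\<^esub>, \<Omega>\<^bsub>01\<^esub>, \<S>),
    (\<Omega>\<^bsub>0*\<^esub> \<union> \<C>, \<Omega>\<^bsub>0*\<^esub>, \<M>),
    (\<Omega>\<^bsub>1*\<^esub> \<union> \<C>, \<Omega>\<^bsub>0*\<^esub>, \<M>),
    (\<Omega>\<^bsub>*0\<^esub> \<union> \<C>, \<Omega>\<^bsub>*1\<^esub>, \<M>),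
    (\<Omega>\<^bsub>*1\<^esub> \<union> \<C>, \<Omega>\<^bsub>*1\<^esub>, \<M>),
    (\<Omega>\<^bsub>0*\<^esub>, \<Omega>\<^bsub>0*\<^esub>, \<Omega>\<^bsub>0*\<^esub>),
    (\<Omega>\<^bsub>1*\<^esub>, \<Omega>\<^bsub>0*\<^esub>, \<Omega>\<^bsub>*1\<^esub>),
    (\<Omega>\<^bsub>*0\<^esub>, \<Omega>\<^bsub>*1\<^esub>, \<Omega>\<^bsub>0*\<^esub>),
    (\<Omega>\<^bsub>*1\<^esub>, \<Omega>\<^bsub>*1\<^esub>, \<Omega>\<^bsub>*1\<^esub>),
    (\<Omega>\<^bsub>00\<^esub> \<union> \<C>, \<Omega>\<^bsub>01\<^esub>, \<M>),
    (\<Omega>\<^bsub>11\<^esub> \<union> \<C>, \<Omega>\<^bsub>01\<^esub>, \<M>),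
    (\<Omega>\<^bsub>00\<^esub>, \<Omega>\<^bsub>01\<^esub>, \<Omega>\<^bsub>0*\<^esub>),
    (\<Omega>\<^bsub>11\<^esub>, \<Omega>\<^bsub>01\<^esub>, \<Omega>\<^bsub>*1\<^esub>),
    (\<Omega>\<^bsub>01\<^esub> \<union> \<C>, \<Omega>\<^bsub>01\<^esub>, \<M>),
    (\<Omega>\<^bsub>10\<^esub> \<union> \<C>, \<Omega>\<^bsub>01\<^esub>, \<M>),
    (\<Omega>\<^bsub>01\<^esub> \<union> \<C>0, \<Omega>\<^bsub>01\<^esub>, \<M>\<^bsub>0*\<^esub>),
    (\<Omega>\<^bsub>10\<^esub> \<union> \<C>1, \<Omega>\<^bsub>01\<^esub>, \<M>\<^bsub>*1\<^esub>),
    (\<Omega>\<^bsub>01\<^esub> \<union> \<C>1, \<Omega>\<^bsub>01\<^esub>, \<M>\<^bsub>*1\<^esub>),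
    (\<Omega>\<^bsub>10\<^esub> \<union> \<C>0, \<Omega>\<^bsub>01\<^esub>, \<M>\<^bsub>0*\<^esub>),
    (\<Omega>\<^bsub>01\<^esub>, \<Omega>\<^bsub>01\<^esub>, \<Omega>\<^bsub>01\<^esub>),
    (\<Omega>\<^bsub>10\<^esub>, \<Omega>\<^bsub>01\<^esub>, \<Omega>\<^bsub>01\<^esub>),
    (\<S>\<^sup>-, \<S>, \<U>2),
    (\<S>\<^sup>+, \<S>, \<W>2),
    (\<S>\<^sup>-\<^bsub>\<noteq>\<^esub>, \<S>\<^bsub>01\<^esub>, \<S>\<M>),
    (\<S>\<^sup>+\<^bsub>\<noteq>\<^esub>, \<S>\<^bsub>01\<^esub>, \<S>\<M>),
    (\<S>\<^sup>-\<^bsub>0*\<^esub>, \<S>\<^bsub>01\<^esub>, \<U>2),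
    (\<S>\<^sup>+\<^bsub>1*\<^esub>, \<S>\<^bsub>01\<^esub>, \<W>2),
    (\<S>\<^sup>-\<^bsub>*0\<^esub>, \<S>\<^bsub>01\<^esub>, \<U>2),
    (\<S>\<^sup>+\<^bsub>*1\<^esub>, \<S>\<^bsub>01\<^esub>, \<W>2),
    (\<S>\<^sup>-\<^bsub>01\<^esub> \<union> \<C>0, \<S>\<^bsub>01\<^esub>, \<M>\<U>2),
    (\<S>\<^sup>+\<^bsub>10\<^esub> \<union> \<C>1, \<S>\<^bsub>01\<^esub>, \<M>\<W>2),
    (\<S>\<^sup>-\<^bsub>10\<^esub> \<union> \<C>0, \<S>\<^bsub>01\<^esub>, \<M>\<U>2),
    (\<S>\<^sup>+\<^bsub>01\<^esub> \<union> \<C>1, \<S>\<^bsub>01\<^esub>, \<M>\<W>2),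
    (\<S>\<^sup>-\<^bsub>01\<^esub>, \<S>\<^bsub>01\<^esub>, \<U>2\<^bsub>01\<^esub>),
    (\<S>\<^sup>+\<^bsub>10\<^esub>, \<S>\<^bsub>01\<^esub>, \<W>2\<^bsub>01\<^esub>),
    (\<S>\<^sup>-\<^bsub>10\<^esub>, \<S>\<^bsub>01\<^esub>, \<U>2\<^bsub>01\<^esub>),
    (\<S>\<^sup>+\<^bsub>01\<^esub>, \<S>\<^bsub>01\<^esub>, \<W>2\<^bsub>01\<^esub>),
    (\<S>\<^sup>-\<^bsub>00\<^esub>, \<S>\<^bsub>01\<^esub>, \<U>2),
    (\<S>\<^sup>+\<^bsub>11\<^esub>, \<S>\<^bsub>01\<^esub>, \<W>2),
    (\<S>, \<S>, \<S>),
    (\<S>\<^bsub>01\<^esub>, \<S>\<^bsub>01\<^esub>, \<S>\<^bsub>01\<^esub>),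
    (\<S>\<^bsub>10\<^esub>, \<S>\<^bsub>01\<^esub>, \<S>\<^bsub>01\<^esub>),
    (\<M>, \<M>, \<M>),
    (neg \<M>, \<M>, \<M>),
    (\<M>\<^bsub>0*\<^esub>, \<M>\<^bsub>0*\<^esub>, \<M>\<^bsub>0*\<^esub>),
    ((neg \<M>)\<^bsub>1*\<^esub>, \<M>\<^bsub>0*\<^esub>, \<M>\<^bsub>*1\<^esub>),
    (\<M>\<^bsub>*1\<^esub>, \<M>\<^bsub>*1\<^esub>, \<M>\<^bsub>*1\<^esub>),
    ((neg \<M>)\<^bsub>*0\<^esub>, \<M>\<^bsub>*1\<^esub>, \<M>\<^bsub>0*\<^esub>),
    (\<M>\<^bsub>01\<^esub>, \<M>\<^bsub>01\<^esub>, \<M>\<^bsub>01\<^esub>),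
    ((neg \<M>)\<^bsub>10\<^esub>, \<M>\<^bsub>01\<^esub>, \<M>\<^bsub>01\<^esub>),
    (\<S>\<M>, \<S>\<M>, \<S>\<M>),
    (neg \<S>\<M>, \<S>\<M>, \<S>\<M>),
    (\<U>2, \<U>2, \<U>2),
    (neg \<U>2, \<U>2, \<W>2),
    (\<U>2\<^bsub>01\<^esub> \<union> \<C>0, \<U>2\<^bsub>01\<^esub>, \<M>\<U>2),
    ((neg \<U>2)\<^bsub>10\<^esub> \<union> \<C>1, \<U>2\<^bsub>01\<^esub>, \<M>\<W>2),
    (\<U>2\<^bsub>01\<^esub>, \<U>2\<^bsub>01\<^esub>, \<U>2\<^bsub>01\<^esub>),
    ((neg \<U>2)\<^bsub>10\<^esub>, \<U>2\<^bsub>01\<^esub>, \<W>2\<^bsub>01\<^esub>),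
    (\<M>\<U>2, \<M>\<U>2, \<M>\<U>2),
    (neg \<M>\<U>2, \<M>\<U>2, \<M>\<W>2),
    (\<M>\<U>2\<^bsub>01\<^esub>, \<M>\<U>2\<^bsub>01\<^esub>, \<M>\<U>2\<^bsub>01\<^esub>),
    ((neg \<M>\<U>2)\<^bsub>10\<^esub>, \<M>\<U>2\<^bsub>01\<^esub>, \<M>\<W>2\<^bsub>01\<^esub>),
    (\<W>2, \<W>2, \<W>2),
    (neg \<W>2, \<W>2, \<U>2),
    (\<W>2\<^bsub>01\<^esub> \<union> \<C>1, \<W>2\<^bsub>01\<^esub>, \<M>\<W>2),
    ((neg \<W>2)\<^bsub>10\<^esub> \<union> \<C>0, \<W>2\<^bsub>01\<^esub>, \<M>\<U>2),
    (\<W>2\<^bsub>01\<^esub>, \<W>2\<^bsub>01\<^esub>, \<W>2\<^bsub>01\<^esub>),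
    ((neg \<W>2)\<^bsub>10\<^esub>, \<W>2\<^bsub>01\<^esub>, \<U>2\<^bsub>01\<^esub>),
    (\<M>\<W>2, \<M>\<W>2, \<M>\<W>2),
    (neg \<M>\<W>2, \<M>\<W>2, \<M>\<U>2),
    (\<M>\<W>2\<^bsub>01\<^esub>, \<M>\<W>2\<^bsub>01\<^esub>, \<M>\<W>2\<^bsub>01\<^esub>),
    ((neg \<M>\<W>2)\<^bsub>10\<^esub>, \<M>\<W>2\<^bsub>01\<^esub>, \<M>\<U>2\<^bsub>01\<^esub>),
    (\<U>2\<^bsub>00\<^esub>, \<U>2\<^bsub>01\<^esub>, \<U>2),
    ((neg \<U>2)\<^bsub>11\<^esub>, \<U>2\<^bsub>01\<^esub>, \<W>2),
    (\<W>2\<^bsub>11\<^esub>, \<W>2\<^bsub>01\<^esub>, \<W>2),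
    ((neg \<W>2)\<^bsub>00\<^esub>, \<W>2\<^bsub>01\<^esub>, \<U>2),
    (\<U>2 \<inter> neg \<W>2, \<S>\<M>, \<U>2),
    (\<W>2 \<inter> neg \<U>2, \<S>\<M>, \<W>2),
    (\<R>, \<S>, \<Omega>),
    (\<R>\<^bsub>00\<^esub> \<union> \<C>, \<S>\<^bsub>01\<^esub>, \<M>),
    (\<R>\<^bsub>11\<^esub> \<union> \<C>, \<S>\<^bsub>01\<^esub>, \<M>),
    (\<R>\<^bsub>00\<^esub>, \<S>\<^bsub>01\<^esub>, \<Omega>\<^bsub>0*\<^esub>),
    (\<R>\<^bsub>11\<^esub>, \<S>\<^bsub>01\<^esub>, \<Omega>\<^bsub>*1\<^esub>),
    (\<C>, \<Omega>, \<Omega>),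
    (\<C>0, \<Omega>, \<Omega>\<^bsub>0*\<^esub>),
    (\<C>1, \<Omega>, \<Omega>\<^bsub>*1\<^esub>),
    ({}, \<Omega>, \<Omega>)
  ]"

end

theory Submission
  imports Defs
begin

text \<open>
  Two points \<open>a, b\<close> of a cube form a matrix with two rows, whose set of columns \<open>set (zip a b)\<close> is a
  binary relation on \<open>{0,1}\<close>; the profile of a class \<open>K\<close> maps a relation \<open>T\<close> to the set of pairs
  \<open>(f(a), f(b))\<close> with \<open>f \<in> K\<close> and all columns in \<open>T\<close>.  A stable class is closed under minors and under
  the majority function, so by the Baker--Pixley argument it is determined by its profile.  Conversely,
  a monotone map on binary relations is a profile as soon as it is consistent on triples of points,
  because a partial function on a cube then extends point by point (path consistency solves 2-SAT).
  Stable classes thus correspond to consistent maps, of which a finite search finds 93.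

  Profiles turn composition of classes into composition of maps.  Hence \<open>K \<cdot> C \<subseteq> K\<close> says that the
  profile \<open>v\<close> of \<open>K\<close> satisfies \<open>v (T \<union> {p}) \<subseteq> v T\<close> whenever \<open>p\<close> is in the profile of \<open>C\<close> at \<open>T\<close>, and
  \<open>C \<cdot> K \<subseteq> K\<close> says that \<open>C\<close> preserves all relations \<open>v T\<close>.  Both \<open>C\<^sub>1\<^sup>K\<close> and \<open>C\<^sub>2\<^sup>K\<close> are therefore given by
  forbidden pairs (columns, values), as are the classes of the table, and two such descriptions
  define the same class iff the same ones among the 93 consistent maps obey them.
\<close>

section \<open>Profiles and the Baker--Pixley argument\<close>

definition profile :: "bool_class \<Rightarrow> (bool \<times> bool) set \<Rightarrow> (bool \<times> bool) set" where
  "profile K T = {(val f a, val f b) | f a b.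
     f \<in> K \<and> a \<in> dom_of f \<and> b \<in> dom_of f \<and> set (zip a b) \<subseteq> T}"

text \<open>For monotone \<open>v\<close> this is the largest class whose profile lies below
  \<open>v\<close>; testing each pair of points only at its own set of columns then
  suffices.\<close>

definition preserving :: "((bool \<times> bool) set \<Rightarrow> (bool \<times> bool) set) \<Rightarrow> bool_class" where
  "preserving v = {f \<in> \<Omega>. \<forall>a\<in>dom_of f. \<forall>b\<in>dom_of f. (val f a, val f b) \<in> v (set (zip a b))}"

text \<open>In the last condition \<open>\<phi>\<close> prescribes the entries of a third point in terms of the columns of the
  first two.\<close>

definition consistent :: "((bool \<times> bool) set \<Rightarrow> (bool \<times> bool) set) \<Rightarrow> bool" where
  "consistent v \<longleftrightarrow> mono v \<and> v {} = {} \<and> (\<forall>T. v (T\<inverse>) = (v T)\<inverse>) \<and> v Id \<subseteq> Id \<and>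
     (\<forall>T \<phi>. v T \<subseteq> v ((\<lambda>p. (fst p, \<phi> p)) ` T) O v ((\<lambda>p. (\<phi> p, snd p)) ` T))"

section \<open>Elementary facts on composition, projections and profiles\<close>

lemma class_compI:
  assumes "f \<in> I" "length gs = arity f" "set gs \<subseteq> J" "\<And>g. g \<in> set gs \<Longrightarrow> arity g = m"
  shows "fun_comp m f gs \<in> I \<cdot> J"
  using assms unfolding class_comp_def by blast

lemma class_compE:
  assumes "h \<in> I \<cdot> J"
  obtains m f gs where "h = fun_comp m f gs" "f \<in> I" "length gs = arity f" "set gs \<subseteq> J"
    "\<forall>g\<in>set gs. arity g = m"
  using assms unfolding class_comp_def mem_Collect_eq by blast

lemma arity_fun_comp [simp]: "arity (fun_comp m f gs) = m"
  by (simp add: fun_comp_def)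

lemma val_fun_comp [simp]: "length a = m \<Longrightarrow> val (fun_comp m f gs) a = val f (map (\<lambda>g. val g a) gs)"
  by (simp add: fun_comp_def cube_def)

lemma fun_comp_in_Omega: "1 \<le> m \<Longrightarrow> fun_comp m f gs \<in> \<Omega>"
  by (simp add: fun_comp_def \<Omega>_def)

lemma class_comp_in_Omega:
  assumes "I \<subseteq> \<Omega>" "J \<subseteq> \<Omega>"
  shows "I \<cdot> J \<subseteq> \<Omega>"
proof
  fix h assume "h \<in> I \<cdot> J"
  then obtain m f gs where h: "h = fun_comp m f gs" "f \<in> I" "length gs = arity f" "set gs \<subseteq> J"
    "\<forall>g\<in>set gs. arity g = m"
    by (elim class_compE)
  with assms have "gs \<noteq> []" by (auto simp: \<Omega>_def)
  then have "hd gs \<in> set gs" by simp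
  then have "hd gs \<in> \<Omega>" "arity (hd gs) = m" using h assms by blast+
  then have "1 \<le> m" by (auto simp: \<Omega>_def)
  then show "h \<in> \<Omega>" using h(1) fun_comp_in_Omega by blast
qed

lemma proj_in_J: "i < n \<Longrightarrow> proj n i \<in> \<J>"
  by (auto simp: \<J>_def)

lemma arity_proj [simp]: "arity (proj n i) = n"
  by (simp add: proj_def)

lemma val_proj [simp]: "length a = n \<Longrightarrow> val (proj n i) a = a ! i"
  by (simp add: proj_def cube_def)

lemma J_subset_Omega: "\<J> \<subseteq> \<Omega>"
  by (auto simp: \<J>_def proj_def \<Omega>_def)

lemma Omega_eqI:
  assumes "f \<in> \<Omega>" "g \<in> \<Omega>" "arity f = arity g" "\<And>a. length a = arity f \<Longrightarrow> val f a = val g a"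
  shows "f = g"
  using assms by (intro prod_eqI extensionalityI[of _ "dom_of f"]) (auto simp: \<Omega>_def cube_def)

lemma set_zip_subsetI:
  assumes "length a = length b" "\<And>i. i < length b \<Longrightarrow> (a ! i, b ! i) \<in> T"
  shows "set (zip a b) \<subseteq> T"
  using assms by (auto simp: set_zip)

lemma set_zip_map_map: "set (zip (map f xs) (map g xs)) = (\<lambda>x. (f x, g x)) ` set xs"
  by (induction xs) auto

lemma profileI:
  assumes "f \<in> K" "length a = arity f" "length b = arity f" "set (zip a b) \<subseteq> T"
  shows "(val f a, val f b) \<in> profile K T"
  using assms unfolding profile_def cube_def mem_Collect_eq by (intro exI conjI) (rule refl | assumption)+

lemma profileE:
  assumes "p \<in> profile K T"
  obtains f a b where "p = (val f a, val f b)" "f \<in> K" "length a = arity f" "length b = arity f"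
    "set (zip a b) \<subseteq> T"
  using assms unfolding profile_def cube_def mem_Collect_eq by blast

text \<open>Identifying and permuting variables moves a pair of values to any pair of points whose
  columns include those of the given one.\<close>

lemma profile_attained:
  assumes KJ: "K \<cdot> \<J> \<subseteq> K" and p: "p \<in> profile K (set (zip a b))" and len: "length a = m" "length b = m"
  obtains g where "g \<in> K" "arity g = m" "(val g a, val g b) = p"
proof -
  obtain f c d where f: "p = (val f c, val f d)" "f \<in> K" "length c = arity f" "length d = arity f"
    "set (zip c d) \<subseteq> set (zip a b)"
    using p by (rule profileE)
  have "\<exists>j<m. a ! j = c ! i \<and> b ! j = d ! i" if "i < arity f" for i
  proof -
    have "(c ! i, d ! i) \<in> set (zip c d)"
      using that f(3,4) by (auto simp: set_zip)
    then have "(c ! i, d ! i) \<in> set (zip a b)" using f(5) by blast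
    then show ?thesis using len by (auto simp: set_zip)
  qed
  then obtain j where j: "\<And>i. i < arity f \<Longrightarrow> j i < m \<and> a ! j i = c ! i \<and> b ! j i = d ! i"
    by metis
  define g where "g = fun_comp m f (map (\<lambda>i. proj m (j i)) [0..<arity f])"
  have "g \<in> K \<cdot> \<J>" unfolding g_def using f(2) j by (intro class_compI) (auto simp: proj_in_J)
  moreover have "map (\<lambda>i. a ! j i) [0..<arity f] = c" "map (\<lambda>i. b ! j i) [0..<arity f] = d"
    using f(3,4) j by (auto intro!: nth_equalityI)
  then have "(val g a, val g b) = p"
    using len f(1) by (simp add: g_def comp_def)
  ultimately show ?thesis using KJ that[of g] by (auto simp: g_def)
qed

text \<open>The clauses mirror facts on points. Functions have at least one variable, so two points
  always have a column; swapping the points transposes columns and values; columns in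
  \<open>Id\<close> force the points to be equal.\<close>

lemma consistent_profile:
  assumes "K \<subseteq> \<Omega>"
  shows "consistent (profile K)"
  unfolding consistent_def
proof (intro conjI allI)
  show "mono (profile K)" by (rule monoI) (unfold profile_def, blast)
  show "profile K {} = {}"
  proof (rule equals0I)
    fix p assume "p \<in> profile K {}"
    then obtain f a where "f \<in> K" "length a = arity f" "a = []" by (rule profileE) auto
    then show False using assms by (auto simp: \<Omega>_def)
  qed
  show "profile K (T\<inverse>) = (profile K T)\<inverse>" for T
  proof -
    have sub: "profile K (T\<inverse>) \<subseteq> (profile K T)\<inverse>" for T
    proof
      fix p assume "p \<in> profile K (T\<inverse>)"
      then obtain f a b where f: "p = (val f a, val f b)" "f \<in> K" "length a = arity f"
        "length b = arity f" "set (zip a b) \<subseteq> T\<inverse>"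
        by (rule profileE)
      have "set (zip b a) \<subseteq> T" using f(3-5) by (auto simp: set_zip)
      then have "(val f b, val f a) \<in> profile K T" using f by (intro profileI) auto
      then show "p \<in> (profile K T)\<inverse>" using f(1) by simp
    qed
    from sub[of "T\<inverse>"] sub[of T] show ?thesis by auto
  qed
  show "profile K Id \<subseteq> Id"
  proof
    fix p assume "p \<in> profile K Id"
    then obtain f a b where f: "p = (val f a, val f b)" "length a = arity f"
        "length b = arity f" "set (zip a b) \<subseteq> Id"
      by (rule profileE)
    then have "a = b" by (intro nth_equalityI) (auto simp: set_zip)
    then show "p \<in> Id" using f by simp
  qed
  show "profile K T \<subseteq> profile K ((\<lambda>p. (fst p, \<phi> p)) ` T) O profile K ((\<lambda>p. (\<phi> p, snd p)) ` T)" for T \<phi>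
  proof
    fix p assume "p \<in> profile K T"
    then obtain f a b where f: "p = (val f a, val f b)" "f \<in> K" "length a = arity f"
        "length b = arity f" "set (zip a b) \<subseteq> T"
      by (rule profileE)
    \<comment> \<open>The third point, computed column by column; the value of \<open>f\<close>
      there links the two factors of the relational composition.\<close>
    let ?c = "map \<phi> (zip a b)"
    have in_T: "(a ! i, b ! i) \<in> T" if "i < arity f" for i
      using f(3-5) that by (auto simp: set_zip)
    have *: "(val f a, val f ?c) \<in> profile K ((\<lambda>p. (fst p, \<phi> p)) ` T)"
            "(val f ?c, val f b) \<in> profile K ((\<lambda>p. (\<phi> p, snd p)) ` T)"
      using f(2-4) by (intro profileI set_zip_subsetI; force intro: image_eqI[OF _ in_T])+
    show "p \<in> profile K ((\<lambda>p. (fst p, \<phi> p)) ` T) O profile K ((\<lambda>p. (\<phi> p, snd p)) ` T)"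
      using relcompI[OF *] f(1) by simp
  qed
qed

section \<open>The majority function and interpolation from pairs of points\<close>

definition maj :: bool_fun where
  "maj = (3, \<lambda>a\<in>cube 3. a ! 0 \<and> a ! 1 \<or> a ! 1 \<and> a ! 2 \<or> a ! 0 \<and> a ! 2)"

lemma arity_maj [simp]: "arity maj = 3"
  by (simp add: maj_def)

lemma val_maj [simp]: "val maj [x, y, z] = (x \<and> y \<or> y \<and> z \<or> x \<and> z)"
  by (simp add: maj_def cube_def)

lemma cube_3E:
  assumes "a \<in> cube 3"
  obtains x y z where "a = [x, y, z]"
  using assms by (auto simp: cube_def numeral_3_eq_3 length_Suc_conv)

lemma maj_in_SM: "maj \<in> \<S>\<M>"
proof -
  have "maj \<in> \<Omega>" by (simp add: maj_def \<Omega>_def)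
  then show ?thesis
    unfolding \<S>\<M>_def \<S>_def \<M>_def
    by (auto elim!: cube_3E simp: tuple_compl_def tuple_le_def)
qed

lemma profile_preserving_le: "mono v \<Longrightarrow> profile (preserving v) T \<subseteq> v T"
proof
  fix p assume "mono v" "p \<in> profile (preserving v) T"
  then obtain f a b where f: "p = (val f a, val f b)" "f \<in> preserving v" "length a = arity f"
    "length b = arity f" "set (zip a b) \<subseteq> T"
    by (elim profileE)
  then have "p \<in> v (set (zip a b))" by (auto simp: preserving_def cube_def)
  then show "p \<in> v T" using monoD[OF \<open>mono v\<close> f(5)] by blast
qed

lemma subset_preserving_profile: "K \<subseteq> \<Omega> \<Longrightarrow> K \<subseteq> preserving (profile K)"
  by (auto simp: preserving_def cube_def intro!: profileI)

text \<open>The induction step of the Baker--Pixley argument: the majority of three interpolants, each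
  missing one of three points, misses none of them.\<close>

lemma interpolation:
  assumes SMK: "\<S>\<M> \<cdot> K \<subseteq> K" and "finite D"
    and pairs: "\<And>a b. a \<in> cube m \<Longrightarrow> b \<in> cube m \<Longrightarrow> \<exists>g\<in>K. arity g = m \<and> val g a = F a \<and> val g b = F b"
    and D: "D \<subseteq> cube m"
  shows "\<exists>g\<in>K. arity g = m \<and> (\<forall>a\<in>D. val g a = F a)"
  using \<open>finite D\<close> D
proof (induction "card D" arbitrary: D rule: less_induct)
  case less
  show ?case
  \<comment> \<open>The points \<open>a\<close> and \<open>b\<close> may coincide or lie outside
    \<open>D\<close>, so the first case covers every \<open>D\<close> with at most two
    elements.\<close>
  proof (cases "\<exists>a b. D \<subseteq> {a, b} \<and> {a, b} \<subseteq> cube m")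
    case True
    then obtain a b where "D \<subseteq> {a, b}" "a \<in> cube m" "b \<in> cube m" by blast
    then show ?thesis using pairs[of a b] by blast
  next
    case False
    have "replicate m True \<in> cube m" by (simp add: cube_def)
    then obtain a where a: "a \<in> D" using False by (metis empty_iff empty_subsetI insert_subset subsetI)
    then have a': "a \<in> cube m" using less.prems by blast
    then obtain b where b: "b \<in> D" "b \<noteq> a" using False by blast
    then have "b \<in> cube m" using less.prems by blast
    then obtain c where c: "c \<in> D" "c \<noteq> a" "c \<noteq> b" using False a' by blast
    note abc = a b c
    have IH: "\<exists>g\<in>K. arity g = m \<and> (\<forall>x\<in>D - {d}. val g x = F x)" if "d \<in> D" for d
      using that less.prems by (intro less.hyps card_Diff1_less) auto
    obtain g1 where g1: "g1 \<in> K" "arity g1 = m" "\<forall>x\<in>D - {a}. val g1 x = F x" using IH abc by blast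
    obtain g2 where g2: "g2 \<in> K" "arity g2 = m" "\<forall>x\<in>D - {b}. val g2 x = F x" using IH abc by blast
    obtain g3 where g3: "g3 \<in> K" "arity g3 = m" "\<forall>x\<in>D - {c}. val g3 x = F x" using IH abc by blast
    have "fun_comp m maj [g1, g2, g3] \<in> \<S>\<M> \<cdot> K"
      using g1 g2 g3 by (intro class_compI) (auto intro: maj_in_SM)
    moreover have "val (fun_comp m maj [g1, g2, g3]) x = F x" if "x \<in> D" for x
    proof -
      have "length x = m" using that less.prems by (auto simp: cube_def)
      then show ?thesis using g1(3) g2(3) g3(3) abc that by (cases "x = a"; cases "x = b"; cases "x = c") auto
    qed
    ultimately show ?thesis using SMK by (intro bexI[of _ "fun_comp m maj [g1, g2, g3]"]) auto
  qed
qed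

lemma finite_cube: "finite (cube m)"
  using finite_lists_length_eq[of "UNIV :: bool set" m] by (simp add: cube_def)

text \<open>For \<open>f\<close> in the left-hand class, \<open>profile_attained\<close> supplies a
  member of \<open>K\<close> that agrees with \<open>f\<close> at any two given points;
  interpolation merges these members into one that agrees with \<open>f\<close> on the whole
  cube.\<close>

theorem preserving_profile:
  assumes "stable_class \<J> \<S>\<M> K"
  shows "preserving (profile K) = K"
proof
  have K: "K \<subseteq> \<Omega>" "K \<cdot> \<J> \<subseteq> K" "\<S>\<M> \<cdot> K \<subseteq> K" using assms by (auto simp: stable_class_def)
  show "K \<subseteq> preserving (profile K)" using K by (rule_tac subset_preserving_profile)
  show "preserving (profile K) \<subseteq> K"
  proof
    fix f assume f: "f \<in> preserving (profile K)"
    have "\<exists>g\<in>K. arity g = arity f \<and> val g a = val f a \<and> val g b = val f b"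
      if "a \<in> dom_of f" "b \<in> dom_of f" for a b
    proof -
      have "(val f a, val f b) \<in> profile K (set (zip a b))"
        using f that by (auto simp: preserving_def)
      moreover have "length a = arity f" "length b = arity f" using that by (auto simp: cube_def)
      ultimately obtain g where "g \<in> K" "arity g = arity f" "(val g a, val g b) = (val f a, val f b)"
        by (rule profile_attained[OF K(2)])
      then show ?thesis by blast
    qed
    from interpolation[OF K(3) finite_cube this order_refl]
    obtain g where g: "g \<in> K" "arity g = arity f" "\<forall>a\<in>dom_of f. val g a = val f a" by blast
    have "g = f" using g K(1) f by (intro Omega_eqI) (auto simp: preserving_def cube_def)
    then show "f \<in> K" using g by simp
  qed
qed

text \<open>In each case the columns avoid a pair \<open>(x, y)\<close>, i.e. \<open>a\<close> lies below \<open>b\<close> up to complementing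
  and swapping, and monotonicity with self-duality rules out the pair of values \<open>(x, y)\<close>.\<close>

lemma SM_preserves_binary:
  assumes f: "f \<in> \<S>\<M>" and ab: "length a = arity f" "length b = arity f"
  shows "(val f a, val f b) \<in> set (zip a b)"
proof (rule ccontr)
  assume neg: "\<not> ?thesis"
  have mono: "val f c \<le> val f d"
    if "length c = arity f" "length d = arity f" "\<And>i. i < arity f \<Longrightarrow> c ! i \<Longrightarrow> d ! i" for c d
  proof -
    have "tuple_le c d" using that by (auto simp: tuple_le_def list_all2_conv_all_nth)
    then show ?thesis using f that unfolding \<S>\<M>_def \<M>_def cube_def by auto
  qed
  have dual: "val f (map Not c) = (\<not> val f c)" if "length c = arity f" for c
    using f that by (auto simp: \<S>\<M>_def \<S>_def cube_def tuple_compl_def)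
  have ne: "(a ! i, b ! i) \<noteq> (val f a, val f b)" if "i < arity f" for i
    using neg that ab by (auto simp: set_zip)
  consider "val f a \<and> val f b" | "\<not> val f a \<and> \<not> val f b" | "val f a \<and> \<not> val f b" | "\<not> val f a \<and> val f b"
    by blast
  then show False
    using ab ne mono[of a "map Not b"] mono[of "map Not b" a] mono[of a b] mono[of b a] dual[of b]
    by cases auto
qed

section \<open>Realization of consistent families and stabilizers\<close>

text \<open>The common format of the stable classes and of the stabilizing clones. Phrased through
  \<open>profile {f}\<close>, it makes inclusion of a class depend on the profile of that class
  only.\<close>

definition excluding :: "((bool \<times> bool) set \<times> (bool \<times> bool)) set \<Rightarrow> bool_class" where
  "excluding G = {f \<in> \<Omega>. \<forall>(T, p)\<in>G. p \<notin> profile {f} T}"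

lemma profile_mono: "S \<subseteq> T \<Longrightarrow> profile K S \<subseteq> profile K T"
  unfolding profile_def by blast

lemma profile_class_mono: "K \<subseteq> K' \<Longrightarrow> profile K T \<subseteq> profile K' T"
  unfolding profile_def by blast

lemma profile_UN: "profile K T = (\<Union>f\<in>K. profile {f} T)"
  unfolding profile_def by blast

lemma subset_excluding_iff:
  "K \<subseteq> \<Omega> \<Longrightarrow> K \<subseteq> excluding G \<longleftrightarrow> (\<forall>(T, p)\<in>G. p \<notin> profile K T)"
  unfolding excluding_def profile_UN[of K] by blast

lemma excluding_subset_Omega: "excluding G \<subseteq> \<Omega>"
  by (auto simp: excluding_def)

lemma excluding_avoids: "(T, p) \<in> G \<Longrightarrow> p \<notin> profile (excluding G) T"
  using subset_excluding_iff[OF excluding_subset_Omega, of G G] by blast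

section \<open>Profiles of the projections and of compositions\<close>

text \<open>A projection reads off one column, so \<open>\<J>\<close> is neutral when profiles are
  composed.\<close>

lemma profile_J: "profile \<J> T = T"
proof
  show "profile \<J> T \<subseteq> T"
  proof
    fix p assume "p \<in> profile \<J> T"
    then obtain f a b where f: "p = (val f a, val f b)" "f \<in> \<J>" "length a = arity f"
      "length b = arity f" "set (zip a b) \<subseteq> T"
      by (rule profileE)
    from f(2) obtain n i where "f = proj n i" "i < n" by (auto simp: \<J>_def)
    with f have "p = (a ! i, b ! i)" "i < length (zip a b)" by auto
    then have "p \<in> set (zip a b)" using f(3,4) by (auto simp: set_zip)
    then show "p \<in> T" using f(5) by blast
  qed
  show "T \<subseteq> profile \<J> T"
  proof
    fix p assume "p \<in> T"
    then have "(val (proj 1 0) [fst p], val (proj 1 0) [snd p]) \<in> profile \<J> T"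
      by (intro profileI) (auto simp: proj_in_J)
    then show "p \<in> profile \<J> T" by simp
  qed
qed

lemma profile_SM: "profile \<S>\<M> T \<subseteq> T"
  by (auto elim!: profileE dest: SM_preserves_binary)

text \<open>The inner functions map the two points to two points of the cube of the outer function,
  whose columns are pairs of values of members of \<open>J\<close>.\<close>

lemma profile_comp_le: "profile (I \<cdot> J) T \<subseteq> profile I (profile J T)"
proof
  fix p assume "p \<in> profile (I \<cdot> J) T"
  then obtain h a b where h: "p = (val h a, val h b)" "h \<in> I \<cdot> J" "length a = arity h"
    "length b = arity h" "set (zip a b) \<subseteq> T"
    by (rule profileE)
  from h(2) obtain m f gs where f: "h = fun_comp m f gs" "f \<in> I" "length gs = arity f" "set gs \<subseteq> J"
    "\<forall>g\<in>set gs. arity g = m"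
    by (rule class_compE)
  have "set (zip (map (\<lambda>g. val g a) gs) (map (\<lambda>g. val g b) gs)) \<subseteq> profile J T"
    using f h by (auto simp: set_zip_map_map intro!: profileI)
  then have "(val f (map (\<lambda>g. val g a) gs), val f (map (\<lambda>g. val g b) gs)) \<in> profile I (profile J T)"
    using f by (intro profileI) auto
  then show "p \<in> profile I (profile J T)" using f h by simp
qed

text \<open>Equality needs closure of \<open>J\<close> under minors: the inner functions that
  witness the columns for the outer function may have different arities and be evaluated at
  different points, and must be moved to common ones.\<close>

lemma profile_comp:
  assumes "J \<cdot> \<J> \<subseteq> J" "I \<subseteq> \<Omega>" "J \<subseteq> \<Omega>"
  shows "profile (I \<cdot> J) T = profile I (profile J T)"
proof
  show "profile I (profile J T) \<subseteq> profile (I \<cdot> J) T"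
  proof
    fix p assume "p \<in> profile I (profile J T)"
    then obtain f c d where f: "p = (val f c, val f d)" "f \<in> I" "length c = arity f"
      "length d = arity f" "set (zip c d) \<subseteq> profile J T"
      by (rule profileE)
    \<comment> \<open>Listing \<open>T\<close> gives two points whose set of columns is exactly
      \<open>T\<close>; all inner functions are then found at these two points and share the arity
      \<open>length l\<close>.\<close>
    obtain l where l: "set l = T" using finite_list[of T] by auto
    define a b where "a = map fst l" and "b = map snd l"
    have T: "set (zip a b) = T" and len: "length a = length l" "length b = length l"
      using l by (simp_all add: a_def b_def zip_map_fst_snd)
    have "\<exists>g\<in>J. arity g = length l \<and> val g a = c ! i \<and> val g b = d ! i" if "i < arity f" for i
    proof -
      have "(c ! i, d ! i) \<in> profile J (set (zip a b))"
        using f(3-5) that unfolding T by (auto simp: set_zip)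
      then obtain g where "g \<in> J" "arity g = length l" "(val g a, val g b) = (c ! i, d ! i)"
        using len by (rule profile_attained[OF assms(1)])
      then show ?thesis by blast
    qed
    then obtain g where g: "\<And>i. i < arity f \<Longrightarrow>
        g i \<in> J \<and> arity (g i) = length l \<and> val (g i) a = c ! i \<and> val (g i) b = d ! i"
      by metis
    let ?h = "fun_comp (length l) f (map g [0..<arity f])"
    have "?h \<in> I \<cdot> J" using f(2) g by (intro class_compI) auto
    moreover have "map (\<lambda>i. val (g i) a) [0..<arity f] = c" "map (\<lambda>i. val (g i) b) [0..<arity f] = d"
      using f(3,4) g by (auto intro!: nth_equalityI)
    then have "p = (val ?h a, val ?h b)" using len f(1) by (simp add: comp_def)
    moreover have "(val ?h a, val ?h b) \<in> profile (I \<cdot> J) T" if "?h \<in> I \<cdot> J"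
      using that T len by (intro profileI) auto
    ultimately show "p \<in> profile (I \<cdot> J) T" by simp
  qed
qed (rule profile_comp_le)

text \<open>Composing with projections on the right or with \<open>\<S>\<M>\<close> on the left does
  not enlarge a profile, because \<open>profile \<J>\<close> is the identity and
  \<open>\<S>\<M>\<close> preserves every binary relation.\<close>

lemma excluding_stable: "stable_class \<J> \<S>\<M> (excluding G)"
proof -
  have J: "excluding G \<cdot> \<J> \<subseteq> \<Omega>"
    by (intro class_comp_in_Omega excluding_subset_Omega J_subset_Omega)
  have "\<S>\<M> \<subseteq> \<Omega>" by (auto simp: \<S>\<M>_def \<S>_def)
  then have SM: "\<S>\<M> \<cdot> excluding G \<subseteq> \<Omega>"
    by (intro class_comp_in_Omega excluding_subset_Omega)
  have "profile (excluding G \<cdot> \<J>) T \<subseteq> profile (excluding G) T" for T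
    using profile_comp_le[of "excluding G" \<J>] by (simp add: profile_J)
  moreover have "profile (\<S>\<M> \<cdot> excluding G) T \<subseteq> profile (excluding G) T" for T
    using profile_comp_le profile_SM by blast
  ultimately show ?thesis
    unfolding stable_class_def subset_excluding_iff[OF J] subset_excluding_iff[OF SM]
    using excluding_subset_Omega excluding_avoids by fast
qed

section \<open>Realizing consistent maps by functions\<close>

lemma preserving_eq_excluding: "mono v \<Longrightarrow> preserving v = excluding {(T, p). p \<notin> v T}"
proof (intro equalityI)
  assume "mono v"
  have "preserving v \<subseteq> \<Omega>" by (auto simp: preserving_def)
  then show "preserving v \<subseteq> excluding {(T, p). p \<notin> v T}"
    using profile_preserving_le[OF \<open>mono v\<close>] by (auto simp: subset_excluding_iff)
next
  show "excluding {(T, p). p \<notin> v T} \<subseteq> preserving v"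
    by (auto simp: excluding_def preserving_def cube_def intro!: profileI)
qed

lemma preserving_subset_excluding_iff:
  assumes "profile (preserving v) = v"
  shows "preserving v \<subseteq> excluding G \<longleftrightarrow> (\<forall>(T, p)\<in>G. p \<notin> v T)"
  using assms by (subst subset_excluding_iff) (auto simp: preserving_def)

text \<open>Since the values are Boolean, if neither value is possible at the new point then each is
  excluded by a single old point, and these two points contradict consistency.\<close>

lemma extend_by_point:
  assumes v: "consistent v" and D: "D \<subseteq> cube m" "D \<noteq> {}" and e: "length e = m"
    and F: "\<And>c d. c \<in> D \<Longrightarrow> d \<in> D \<Longrightarrow> (F c, F d) \<in> v (set (zip c d))"
  obtains z where "(z, z) \<in> v (set (zip e e))" "\<And>c. c \<in> D \<Longrightarrow> (F c, z) \<in> v (set (zip c e))"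
    "\<And>c. c \<in> D \<Longrightarrow> (z, F c) \<in> v (set (zip e c))"
proof -
  have mono: "S \<subseteq> T \<Longrightarrow> v S \<subseteq> v T" for S T using v by (simp add: consistent_def monoD)
  have lift: "v T \<subseteq> v ((\<lambda>p. (fst p, \<phi> p)) ` T) O v ((\<lambda>p. (\<phi> p, snd p)) ` T)" for T \<phi>
    using v by (simp add: consistent_def)
  have swap: "(x, y) \<in> v (set (zip a b)) \<longleftrightarrow> (y, x) \<in> v (set (zip b a))"
    if "length a = m" "length b = m" for x y a b
  proof -
    have "set (zip b a) = (set (zip a b))\<inverse>" using that by (auto simp: set_zip)
    then have "v (set (zip b a)) = (v (set (zip a b)))\<inverse>" using v by (simp add: consistent_def)
    then show ?thesis by simp
  qed
  have common: "\<exists>z. (F c, z) \<in> v (set (zip c e)) \<and> (F d, z) \<in> v (set (zip d e))"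
    if "c \<in> D" "d \<in> D" for c d
  proof -
    have len: "length c = m" "length d = m" using that D by (auto simp: cube_def)
    \<comment> \<open>A column of \<open>c\<close> and \<open>d\<close> may occur at several
      positions with different entries of \<open>e\<close>; \<open>\<phi>\<close> selects one such
      entry, so that the lifted columns are among those really present.\<close>
    have "\<forall>p\<in>set (zip c d). \<exists>y. (fst p, y) \<in> set (zip c e) \<and> (y, snd p) \<in> set (zip e d)"
      using len e by (fastforce simp: set_zip)
    then obtain \<phi> where \<phi>: "\<forall>p\<in>set (zip c d). (fst p, \<phi> p) \<in> set (zip c e) \<and> (\<phi> p, snd p) \<in> set (zip e d)"
      by metis
    have "(F c, F d) \<in> v (set (zip c e)) O v (set (zip e d))"
      using F[OF that] lift[of "set (zip c d)" \<phi>]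
        mono[of "(\<lambda>p. (fst p, \<phi> p)) ` set (zip c d)" "set (zip c e)"]
        mono[of "(\<lambda>p. (\<phi> p, snd p)) ` set (zip c d)" "set (zip e d)"] \<phi>
      by blast
    then show ?thesis using swap[OF len(2) e] by blast
  qed
  have "\<exists>z. \<forall>c\<in>D. (F c, z) \<in> v (set (zip c e))"
  proof (rule ccontr)
    assume "\<not> ?thesis"
    then obtain c d where cd: "c \<in> D" "(F c, False) \<notin> v (set (zip c e))"
      "d \<in> D" "(F d, True) \<notin> v (set (zip d e))"
      by blast
    obtain z where "(F c, z) \<in> v (set (zip c e))" "(F d, z) \<in> v (set (zip d e))"
      using common cd by blast
    then show False using cd by (cases z) auto
  qed
  then obtain z where z: "\<And>c. c \<in> D \<Longrightarrow> (F c, z) \<in> v (set (zip c e))" by blast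
  obtain c where c: "c \<in> D" using D by blast
  then have len: "length c = m" using D by (auto simp: cube_def)
  \<comment> \<open>Taking \<open>e\<close> itself as third point between \<open>c\<close> and
    \<open>e\<close>, that is \<open>\<phi> = snd\<close>, yields a pair \<open>(z', z)\<close> at
    the columns of \<open>e\<close> with itself, where only diagonal values are possible.\<close>
  have "snd ` set (zip c e) = set e" using len e by (metis set_map map_snd_zip)
  then have "(\<lambda>p. (snd p, snd p)) ` set (zip c e) \<subseteq> set (zip e e)"
    by (auto simp: zip_same_conv_map)
  then have "v ((\<lambda>p. (snd p, snd p)) ` set (zip c e)) \<subseteq> v (set (zip e e))" by (rule mono)
  then have "(F c, z) \<in> v ((\<lambda>p. (fst p, snd p)) ` set (zip c e)) O v (set (zip e e))"
    using z[OF c] lift[of "set (zip c e)" snd] by blast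
  then obtain z' where "(z', z) \<in> v (set (zip e e))" by blast
  moreover have "v (set (zip e e)) \<subseteq> Id"
  proof -
    have "set (zip e e) \<subseteq> Id" by (auto simp: zip_same_conv_map)
    then have "v (set (zip e e)) \<subseteq> v Id" by (rule mono)
    then show ?thesis using v unfolding consistent_def by blast
  qed
  ultimately have "(z, z) \<in> v (set (zip e e))" by auto
  moreover have "(z, F c) \<in> v (set (zip e c))" if "c \<in> D" for c
  proof -
    have "length c = m" using that D by (auto simp: cube_def)
    then show ?thesis using z[OF that] swap[OF _ e] by blast
  qed
  ultimately show ?thesis using that z by blast
qed

lemma extend_by_points:
  assumes v: "consistent v" and "finite E" "E \<subseteq> cube m" and D: "D \<subseteq> cube m" "D \<noteq> {}"
    and F: "\<And>c d. c \<in> D \<Longrightarrow> d \<in> D \<Longrightarrow> (F c, F d) \<in> v (set (zip c d))"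
  shows "\<exists>F'. (\<forall>c\<in>D. F' c = F c) \<and> (\<forall>c\<in>D \<union> E. \<forall>d\<in>D \<union> E. (F' c, F' d) \<in> v (set (zip c d)))"
  using assms(2,3)
proof (induction E)
  case empty
  then show ?case using F by auto
next
  case (insert e E)
  then obtain F' where F': "\<forall>c\<in>D. F' c = F c" "\<forall>c\<in>D \<union> E. \<forall>d\<in>D \<union> E. (F' c, F' d) \<in> v (set (zip c d))"
    by auto
  show ?case
  proof (cases "e \<in> D")
    case True
    then show ?thesis using F' by (intro exI[of _ F']) (auto simp: insert_absorb)
  next
    case False
    have "D \<union> E \<subseteq> cube m" "D \<union> E \<noteq> {}" "length e = m" using D insert.prems by (auto simp: cube_def)
    then obtain z where "(z, z) \<in> v (set (zip e e))" "\<And>c. c \<in> D \<union> E \<Longrightarrow> (F' c, z) \<in> v (set (zip c e))"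
      "\<And>c. c \<in> D \<union> E \<Longrightarrow> (z, F' c) \<in> v (set (zip e c))"
      using extend_by_point[OF v, of "D \<union> E" m e F'] F'(2) by metis
    then show ?thesis using F' False insert.hyps by (intro exI[of _ "F'(e := z)"]) auto
  qed
qed

text \<open>The values \<open>p\<close> are prescribed at two points with column set exactly
  \<open>T\<close>. This two-point function satisfies all conditions imposed by \<open>v\<close>, so
  it extends to the whole cube and attains \<open>p\<close>.\<close>

theorem profile_preserving:
  assumes v: "consistent v"
  shows "profile (preserving v) = v"
proof (rule ext, rule equalityI)
  fix T
  show "profile (preserving v) T \<subseteq> v T"
    using v by (intro profile_preserving_le) (simp add: consistent_def)
  show "v T \<subseteq> profile (preserving v) T"
  proof
    fix p assume p: "p \<in> v T"
    obtain l where l: "set l = T" using finite_list[of T] by auto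
    define a b where "a = map fst l" and "b = map snd l"
    have T: "set (zip a b) = T" and len: "length a = length l" "length b = length l"
      using l by (simp_all add: a_def b_def zip_map_fst_snd)
    \<comment> \<open>This makes the arity \<open>length l\<close> positive.\<close>
    have "T \<noteq> {}" using p v by (auto simp: consistent_def)
    then have "l \<noteq> []" using l by auto
    obtain x y where xy: "p = (x, y)" by (cases p)
    have lift: "v T \<subseteq> v ((\<lambda>p. (fst p, \<phi> p)) ` T) O v ((\<lambda>p. (\<phi> p, snd p)) ` T)" for \<phi>
      using v by (simp add: consistent_def)
    have diag: "v (set (zip c c)) \<subseteq> Id" for c
    proof -
      have "set (zip c c) \<subseteq> Id" by (auto simp: zip_same_conv_map)
      then have "v (set (zip c c)) \<subseteq> v Id" using v by (auto simp: consistent_def dest: monoD)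
      then show ?thesis using v by (auto simp: consistent_def)
    qed
    \<comment> \<open>The conditions at a single point come from consistency with the first or the
      second point repeated as third point.\<close>
    have "(\<lambda>p. (fst p, fst p)) ` T = set (zip a a)" "(\<lambda>p. (snd p, snd p)) ` T = set (zip b b)"
      using l by (auto simp: a_def b_def zip_same_conv_map)
    then have "(x, y) \<in> v (set (zip a a)) O v ((\<lambda>p. (fst p, snd p)) ` T)"
        "(x, y) \<in> v ((\<lambda>p. (fst p, snd p)) ` T) O v (set (zip b b))"
      using lift[of fst] lift[of snd] p xy by auto
    then have "(x, x) \<in> v (set (zip a a))" "(y, y) \<in> v (set (zip b b))"
      using diag[of a] diag[of b] by blast+
    moreover have "(y, x) \<in> v (set (zip b a))"
    proof -
      have "set (zip b a) = T\<inverse>" using T len by (auto simp: set_zip)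
      then have "v (set (zip b a)) = (v T)\<inverse>" using v by (simp add: consistent_def)
      then show ?thesis using p xy by simp
    qed
    \<comment> \<open>The two points coincide when all columns are diagonal; the prescription
      \<open>F\<close> is still well defined then.\<close>
    moreover have "x = y" if "a = b" using diag[of a] p xy T that by auto
    moreover define F where "F = (\<lambda>c. if c = a then x else y)"
    ultimately have F: "F a = x" "F b = y"
      "\<And>c d. c \<in> {a, b} \<Longrightarrow> d \<in> {a, b} \<Longrightarrow> (F c, F d) \<in> v (set (zip c d))"
      using p xy T by (auto split: if_splits)
    have "{a, b} \<subseteq> cube (length l)" using len by (auto simp: cube_def)
    from extend_by_points[OF v finite_cube order_refl this _ F(3)]
    obtain F' where F': "F' a = x" "F' b = y"
      "\<forall>c\<in>cube (length l). \<forall>d\<in>cube (length l). (F' c, F' d) \<in> v (set (zip c d))"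
      using F by auto
    let ?f = "(length l, restrict F' (cube (length l)))"
    have "?f \<in> preserving v" using F'(3) \<open>l \<noteq> []\<close> by (auto simp: preserving_def \<Omega>_def Suc_le_eq)
    then have "(val ?f a, val ?f b) \<in> profile (preserving v) T"
      using len T by (intro profileI) auto
    then show "p \<in> profile (preserving v) T" using F' xy len by (simp add: cube_def)
  qed
qed

lemma stable_preserving: "consistent v \<Longrightarrow> stable_class \<J> \<S>\<M> (preserving v)"
  by (simp add: consistent_def preserving_eq_excluding excluding_stable)

theorem stable_classes_eq: "{K. stable_class \<J> \<S>\<M> K} = preserving ` {v. consistent v}"
proof -
  have "K \<in> preserving ` {v. consistent v}" if "stable_class \<J> \<S>\<M> K" for K
    using preserving_profile[OF that] consistent_profile[of K] that
    by (intro image_eqI[of _ _ "profile K"]) (auto simp: stable_class_def)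
  then show ?thesis using stable_preserving by auto
qed

lemma inj_on_preserving: "inj_on preserving {v. consistent v}"
  by (rule inj_on_inverseI[of _ profile]) (simp add: profile_preserving)

section \<open>Stabilizing clones as classes with forbidden pairs\<close>

definition right_constraints :: "((bool \<times> bool) set \<Rightarrow> (bool \<times> bool) set) \<Rightarrow> ((bool \<times> bool) set \<times> (bool \<times> bool)) set" where
  "right_constraints v = {(T, p). \<not> v (insert p T) \<subseteq> v T}"

definition left_constraints :: "((bool \<times> bool) set \<Rightarrow> (bool \<times> bool) set) \<Rightarrow> ((bool \<times> bool) set \<times> (bool \<times> bool)) set" where
  "left_constraints v = {(v T, p) | T p. p \<notin> v T}"

lemma mem_right_constraints: "(T, p) \<in> right_constraints v \<longleftrightarrow> \<not> v (insert p T) \<subseteq> v T"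
  by (simp add: right_constraints_def)

text \<open>A constraint speaks of adding a single pair to \<open>T\<close>. As
  \<open>profile C T\<close> is finite, its pairs can be added one after another, each of them
  remaining in the profile at the enlarged relation.\<close>

lemma subset_right_iff:
  assumes "mono v" "C \<subseteq> \<Omega>" and refl: "\<And>T. T \<subseteq> profile C T"
  shows "C \<subseteq> excluding (right_constraints v) \<longleftrightarrow> (\<forall>T. v (profile C T) \<subseteq> v T)"
proof
  assume "\<forall>T. v (profile C T) \<subseteq> v T"
  moreover have "v (insert p T) \<subseteq> v (profile C T)" if "p \<in> profile C T" for T p
    using that refl by (intro monoD[OF assms(1)]) auto
  ultimately show "C \<subseteq> excluding (right_constraints v)"
    unfolding subset_excluding_iff[OF assms(2)] right_constraints_def by blast
next
  assume C: "C \<subseteq> excluding (right_constraints v)"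
  show "\<forall>T. v (profile C T) \<subseteq> v T"
  proof
    fix T
    have "v (T \<union> X) \<subseteq> v T" if "finite X" "X \<subseteq> profile C T" for X
      using that
    proof (induction X)
      case (insert p X)
      then have "p \<in> profile C (T \<union> X)" using profile_mono[of T "T \<union> X" C] by auto
      then have "v (insert p (T \<union> X)) \<subseteq> v (T \<union> X)"
        using C unfolding subset_excluding_iff[OF assms(2)] right_constraints_def by blast
      then show ?case using insert by auto
    qed simp
    from this[of "profile C T"] show "v (profile C T) \<subseteq> v T"
      using refl[of T] by (simp add: Un_absorb1)
  qed
qed

lemma subset_left_iff:
  assumes "C \<subseteq> \<Omega>"
  shows "C \<subseteq> excluding (left_constraints v) \<longleftrightarrow> (\<forall>T. profile C (v T) \<subseteq> v T)"
  unfolding subset_excluding_iff[OF assms] left_constraints_def by blast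

lemma clone_refl: "\<J> \<subseteq> C \<Longrightarrow> T \<subseteq> profile C T"
  using profile_class_mono[of \<J> C T] by (simp add: profile_J)

text \<open>The profile of a product lies below the iterated profile, so applying
  \<open>v (profile C T) \<subseteq> v T\<close> twice gives closure under composition.\<close>

lemma clone_right:
  assumes "mono v"
  shows "clone (excluding (right_constraints v))" (is "clone ?C")
proof -
  have J: "\<J> \<subseteq> ?C"
    using assms by (simp add: subset_right_iff J_subset_Omega profile_J)
  note refl = clone_refl[OF J]
  have right: "v (profile ?C T) \<subseteq> v T" for T
    using subset_right_iff[OF assms excluding_subset_Omega refl] by blast
  have CC: "?C \<cdot> ?C \<subseteq> \<Omega>" by (intro class_comp_in_Omega excluding_subset_Omega)
  have "v (insert p T) \<subseteq> v T" if "p \<in> profile (?C \<cdot> ?C) T" for p T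
  proof -
    have "insert p T \<subseteq> profile ?C (profile ?C T)"
      using that profile_comp_le refl by blast
    then have "v (insert p T) \<subseteq> v (profile ?C (profile ?C T))" by (rule monoD[OF assms])
    then show ?thesis using right by blast
  qed
  then have "?C \<cdot> ?C \<subseteq> ?C"
    unfolding subset_excluding_iff[OF CC] by (auto simp: mem_right_constraints)
  then show ?thesis using J excluding_subset_Omega by (simp add: clone_def)
qed

text \<open>These are the functions preserving every relation \<open>v T\<close>, and closure under
  composition is that of a polymorphism clone.\<close>

lemma clone_left: "clone (excluding (left_constraints v))" (is "clone ?C")
proof -
  have J: "\<J> \<subseteq> ?C"
    by (simp add: subset_left_iff J_subset_Omega profile_J)
  have left: "profile ?C (v T) \<subseteq> v T" for T
    using subset_left_iff[OF excluding_subset_Omega] by blast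
  have CC: "?C \<cdot> ?C \<subseteq> \<Omega>" by (intro class_comp_in_Omega excluding_subset_Omega)
  have "profile (?C \<cdot> ?C) (v T) \<subseteq> v T" for T
    using profile_comp_le[of ?C ?C "v T"] profile_mono[OF left, of ?C T] left[of T] by blast
  then have "?C \<cdot> ?C \<subseteq> ?C" by (simp add: subset_left_iff[OF CC])
  then show ?thesis using J excluding_subset_Omega by (simp add: clone_def)
qed

lemma clone_comp_J: "clone C \<Longrightarrow> C \<cdot> \<J> \<subseteq> C"
  unfolding clone_def class_comp_def by blast

text \<open>By \<open>profile_comp\<close> the profile of a product is the composite of the
  profiles, and a class lies in \<open>preserving v\<close> iff its profile lies below
  \<open>v\<close>. This turns both inclusions into conditions on \<open>profile C\<close>.\<close>

theorem stabilizers: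
  assumes v: "consistent v" and C: "clone C"
  shows "preserving v \<cdot> C \<subseteq> preserving v \<longleftrightarrow> C \<subseteq> excluding (right_constraints v)" (is ?right)
    and "C \<cdot> preserving v \<subseteq> preserving v \<longleftrightarrow> C \<subseteq> excluding (left_constraints v)" (is ?left)
proof -
  let ?K = "preserving v"
  have mono: "mono v" using v by (simp add: consistent_def)
  have K: "?K \<subseteq> \<Omega>" "?K \<cdot> \<J> \<subseteq> ?K" using stable_preserving[OF v] by (auto simp: stable_class_def)
  have C': "C \<subseteq> \<Omega>" "\<J> \<subseteq> C" "C \<cdot> \<J> \<subseteq> C" using C clone_comp_J by (auto simp: clone_def)
  have le: "L \<subseteq> ?K \<longleftrightarrow> (\<forall>T. profile L T \<subseteq> v T)" if "L \<subseteq> \<Omega>" for L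
    using that mono by (auto simp: preserving_eq_excluding subset_excluding_iff)
  have "?K \<cdot> C \<subseteq> ?K \<longleftrightarrow> (\<forall>T. v (profile C T) \<subseteq> v T)"
    using K C' by (simp add: le class_comp_in_Omega profile_comp profile_preserving[OF v])
  then show ?right
    using subset_right_iff[OF mono C'(1) clone_refl[OF C'(2)]] by simp
  have "C \<cdot> ?K \<subseteq> ?K \<longleftrightarrow> (\<forall>T. profile C (v T) \<subseteq> v T)"
    using K C' by (simp add: le class_comp_in_Omega profile_comp profile_preserving[OF v])
  then show ?left
    using subset_left_iff[OF C'(1)] by simp
qed

section \<open>Coding consistent families\<close>

text \<open>\<open>Rel p q r s\<close> lists the membership of \<open>00\<close>, \<open>01\<close>, \<open>10\<close>, \<open>11\<close>.  Below, the hexadecimal digit in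
  the names \<open>r0, \<dots>, rF\<close> has these as its bits of weight 1, 2, 4, 8.\<close>

datatype rel = Rel bool bool bool bool

fun set_of :: "rel \<Rightarrow> (bool \<times> bool) set" where
  "set_of (Rel p q r s) = {(x, y). if x then (if y then s else r) else (if y then q else p)}"

definition rel_of :: "(bool \<times> bool) set \<Rightarrow> rel" where
  "rel_of T = Rel ((False, False) \<in> T) ((False, True) \<in> T) ((True, False) \<in> T) ((True, True) \<in> T)"

lemma set_of_rel_of [simp]: "set_of (rel_of T) = T"
  by (auto simp: rel_of_def split: if_splits) (metis (full_types))+

lemma rel_of_set_of [simp]: "rel_of (set_of r) = r"
  by (cases r) (simp add: rel_of_def)

lemma all_set_iff_rel: "(\<forall>T. P T) \<longleftrightarrow> (\<forall>r. P (set_of r))"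
  by (metis set_of_rel_of)

section \<open>Operations on coded relations\<close>

fun rel_mem :: "rel \<Rightarrow> bool \<Rightarrow> bool \<Rightarrow> bool" where
  "rel_mem (Rel p q r s) x y = (if x then (if y then s else r) else (if y then q else p))"

fun rel_le :: "rel \<Rightarrow> rel \<Rightarrow> bool" where
  "rel_le (Rel p q r s) (Rel p' q' r' s') \<longleftrightarrow> (p \<longrightarrow> p') \<and> (q \<longrightarrow> q') \<and> (r \<longrightarrow> r') \<and> (s \<longrightarrow> s')"

fun rel_ins :: "rel \<Rightarrow> bool \<Rightarrow> bool \<Rightarrow> rel" where
  "rel_ins (Rel p q r s) x y = Rel (p \<or> \<not> x \<and> \<not> y) (q \<or> \<not> x \<and> y) (r \<or> x \<and> \<not> y) (s \<or> x \<and> y)"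

fun rel_conv :: "rel \<Rightarrow> rel" where
  "rel_conv (Rel p q r s) = Rel p r q s"

fun rel_comp :: "rel \<Rightarrow> rel \<Rightarrow> rel" where
  "rel_comp (Rel p q r s) (Rel p' q' r' s') =
     Rel (p \<and> p' \<or> q \<and> r') (p \<and> q' \<or> q \<and> s') (r \<and> p' \<or> s \<and> r') (r \<and> q' \<or> s \<and> s')"

text \<open>A map \<open>\<phi>\<close> from columns to truth values enters through the set of
  columns on which it is true. This set is the second argument, so both lifted relations in
  \<open>consistent\<close> are computed from two codes.\<close>

fun left_image :: "rel \<Rightarrow> rel \<Rightarrow> rel" where
  "left_image (Rel p q r s) (Rel p' q' r' s') =
     Rel (p \<and> \<not> p' \<or> q \<and> \<not> q') (p \<and> p' \<or> q \<and> q') (r \<and> \<not> r' \<or> s \<and> \<not> s') (r \<and> r' \<or> s \<and> s')"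

fun right_image :: "rel \<Rightarrow> rel \<Rightarrow> rel" where
  "right_image (Rel p q r s) (Rel p' q' r' s') =
     Rel (p \<and> \<not> p' \<or> r \<and> \<not> r') (q \<and> \<not> q' \<or> s \<and> \<not> s') (p \<and> p' \<or> r \<and> r') (q \<and> q' \<or> s \<and> s')"

text \<open>The diagonal on the values attained at the first point, from which the values of a
  consistent map at diagonal relations are recovered.\<close>

fun rel_diag :: "rel \<Rightarrow> rel" where
  "rel_diag (Rel p q r s) = Rel (p \<or> q) False False (r \<or> s)"

lemma rel_mem_iff: "rel_mem r x y \<longleftrightarrow> (x, y) \<in> set_of r"
  by (cases r) auto

lemma rel_le_iff: "rel_le r r' \<longleftrightarrow> set_of r \<subseteq> set_of r'"
  by (cases r; cases r') (auto split: if_splits)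

lemma set_of_ins: "set_of (rel_ins r x y) = insert (x, y) (set_of r)"
  by (cases r) (auto split: if_splits)

lemma set_of_conv: "set_of (rel_conv r) = (set_of r)\<inverse>"
  by (cases r) (auto split: if_splits)

lemma set_of_diag: "set_of (rel_diag r) = Id_on (Domain (set_of r))"
  by (cases r) (auto split: if_splits simp: Domain_unfold)

lemma set_of_comp: "set_of (rel_comp r r') = set_of r O set_of r'"
proof -
  have "(x, y) \<in> set_of (rel_comp r r') \<longleftrightarrow> (x, y) \<in> set_of r O set_of r'" for x y
    by (cases r; cases r') (simp add: relcomp_unfold ex_bool_eq, blast)
  then show ?thesis by auto
qed

lemma set_of_left_lift: "set_of (left_image r w) = (\<lambda>p. (fst p, p \<in> set_of w)) ` set_of r"
proof -
  have "(x, y) \<in> set_of (left_image r w) \<longleftrightarrow> (x, y) \<in> (\<lambda>p. (fst p, p \<in> set_of w)) ` set_of r" for x y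
    by (cases r; cases w) (simp add: image_iff Bex_def split_paired_Ex ex_bool_eq, blast)
  then show ?thesis by auto
qed

lemma set_of_right_lift: "set_of (right_image r w) = (\<lambda>p. (p \<in> set_of w, snd p)) ` set_of r"
proof -
  have "(x, y) \<in> set_of (right_image r w) \<longleftrightarrow> (x, y) \<in> (\<lambda>p. (p \<in> set_of w, snd p)) ` set_of r" for x y
    by (cases r; cases w) (simp add: image_iff Bex_def split_paired_Ex ex_bool_eq, blast)
  then show ?thesis by auto
qed

abbreviation r0 :: rel where "r0 \<equiv> Rel False False False False"
abbreviation r1 :: rel where "r1 \<equiv> Rel True False False False"
abbreviation r2 :: rel where "r2 \<equiv> Rel False True False False"
abbreviation r3 :: rel where "r3 \<equiv> Rel True True False False"
abbreviation r4 :: rel where "r4 \<equiv> Rel False False True False"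
abbreviation r5 :: rel where "r5 \<equiv> Rel True False True False"
abbreviation r6 :: rel where "r6 \<equiv> Rel False True True False"
abbreviation r7 :: rel where "r7 \<equiv> Rel True True True False"
abbreviation r8 :: rel where "r8 \<equiv> Rel False False False True"
abbreviation r9 :: rel where "r9 \<equiv> Rel True False False True"
abbreviation rA :: rel where "rA \<equiv> Rel False True False True"
abbreviation rB :: rel where "rB \<equiv> Rel True True False True"
abbreviation rC :: rel where "rC \<equiv> Rel False False True True"
abbreviation rD :: rel where "rD \<equiv> Rel True False True True"
abbreviation rE :: rel where "rE \<equiv> Rel False True True True"
abbreviation rF :: rel where "rF \<equiv> Rel True True True True"

text \<open>The values of a consistent map at the remaining relations are converses of those at the eight
  relations stored, or determined by the values of functions at single points.\<close>

datatype fam = Fam rel rel rel rel rel rel rel rel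

fun fam_at :: "fam \<Rightarrow> rel \<Rightarrow> rel" where
  "fam_at (Fam c2 c3 cA cB c6 c7 cE cF) r0 = r0"
| "fam_at (Fam c2 c3 cA cB c6 c7 cE cF) r1 = rel_diag c2"
| "fam_at (Fam c2 c3 cA cB c6 c7 cE cF) r2 = c2"
| "fam_at (Fam c2 c3 cA cB c6 c7 cE cF) r3 = c3"
| "fam_at (Fam c2 c3 cA cB c6 c7 cE cF) r4 = rel_conv c2"
| "fam_at (Fam c2 c3 cA cB c6 c7 cE cF) r5 = rel_conv c3"
| "fam_at (Fam c2 c3 cA cB c6 c7 cE cF) r6 = c6"
| "fam_at (Fam c2 c3 cA cB c6 c7 cE cF) r7 = c7"
| "fam_at (Fam c2 c3 cA cB c6 c7 cE cF) r8 = rel_diag (rel_conv c2)"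
| "fam_at (Fam c2 c3 cA cB c6 c7 cE cF) r9 = rel_diag cB"
| "fam_at (Fam c2 c3 cA cB c6 c7 cE cF) rA = cA"
| "fam_at (Fam c2 c3 cA cB c6 c7 cE cF) rB = cB"
| "fam_at (Fam c2 c3 cA cB c6 c7 cE cF) rC = rel_conv cA"
| "fam_at (Fam c2 c3 cA cB c6 c7 cE cF) rD = rel_conv cB"
| "fam_at (Fam c2 c3 cA cB c6 c7 cE cF) rE = cE"
| "fam_at (Fam c2 c3 cA cB c6 c7 cE cF) rF = cF"

lemma rel_exhaust:
  obtains "r = r0" | "r = r1" | "r = r2" | "r = r3" | "r = r4" | "r = r5" | "r = r6" | "r = r7"
    | "r = r8" | "r = r9" | "r = rA" | "r = rB" | "r = rC" | "r = rD" | "r = rE" | "r = rF"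
  by (cases r) (metis (full_types))

section \<open>Coding consistent maps\<close>

definition decode :: "fam \<Rightarrow> (bool \<times> bool) set \<Rightarrow> (bool \<times> bool) set" where
  "decode c T = set_of (fam_at c (rel_of T))"

definition encode :: "((bool \<times> bool) set \<Rightarrow> (bool \<times> bool) set) \<Rightarrow> fam" where
  "encode v = (let w = (\<lambda>r. rel_of (v (set_of r))) in Fam (w r2) (w r3) (w rA) (w rB) (w r6) (w r7) (w rE) (w rF))"

lemma decode_set_of [simp]: "decode c (set_of r) = set_of (fam_at c r)"
  by (simp add: decode_def)

lemma encode_decode: "encode (decode c) = c"
  by (cases c) (simp add: encode_def Let_def del: set_of.simps)

definition rels :: "rel list" where
  "rels = [r2, r1, r8, r3, rA, rB, r6, r7, rE, rF, r4, r5, rC, rD, r9, r0]"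

lemma set_rels: "set rels = UNIV"
proof -
  have "r \<in> set rels" for r
    by (cases r rule: rel_exhaust) (simp_all add: rels_def)
  then show ?thesis by blast
qed

lemma list_all_rels [simp]: "list_all P rels \<longleftrightarrow> (\<forall>r. P r)"
  by (simp add: list_all_iff set_rels)

text \<open>Emptiness at the empty relation is built into \<open>fam_at\<close>. Only the behaviour
  of \<open>\<phi>\<close> on \<open>T\<close> matters, so \<open>w\<close> ranges over subsets of
  \<open>T\<close>.\<close>

definition consistent_code :: "fam \<Rightarrow> bool" where
  "consistent_code c \<longleftrightarrow>
     list_all (\<lambda>T. fam_at c (rel_conv T) = rel_conv (fam_at c T)
       \<and> list_all (\<lambda>T'. rel_le T T' \<longrightarrow> rel_le (fam_at c T) (fam_at c T')) rels
       \<and> list_all (\<lambda>w. rel_le w T \<longrightarrow> rel_le (fam_at c T) (rel_comp (fam_at c (left_image T w)) (fam_at c (right_image T w)))) rels) rels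
     \<and> rel_le (fam_at c r9) r9"

lemma set_of_r0: "set_of r0 = {}" and set_of_r9: "set_of r9 = Id"
  by (auto split: if_splits)

lemma consistent_decode_iff: "consistent (decode c) \<longleftrightarrow> consistent_code c"
proof -
  have "fam_at c r0 = r0" by (cases c) simp
  then have empty: "decode c {} = {}" using decode_set_of[of c r0] by (simp only: set_of_r0)
  have conv: "(\<forall>T. decode c (T\<inverse>) = (decode c T)\<inverse>) \<longleftrightarrow> (\<forall>T. fam_at c (rel_conv T) = rel_conv (fam_at c T))"
    unfolding all_set_iff_rel[where P = "\<lambda>T. decode c (T\<inverse>) = (decode c T)\<inverse>"]
    by (simp flip: set_of_conv) (metis rel_of_set_of)
  have mono: "mono (decode c) \<longleftrightarrow> (\<forall>T T'. rel_le T T' \<longrightarrow> rel_le (fam_at c T) (fam_at c T'))"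
    unfolding mono_def rel_le_iff by (metis decode_set_of set_of_rel_of)
  have id: "decode c Id \<subseteq> Id \<longleftrightarrow> rel_le (fam_at c r9) r9"
    unfolding rel_le_iff set_of_r9 by (metis decode_set_of set_of_r9)
  have lift: "(\<forall>T \<phi>. decode c T \<subseteq> decode c ((\<lambda>p. (fst p, \<phi> p)) ` T) O decode c ((\<lambda>p. (\<phi> p, snd p)) ` T))
     \<longleftrightarrow> (\<forall>T w. rel_le w T \<longrightarrow> rel_le (fam_at c T) (rel_comp (fam_at c (left_image T w)) (fam_at c (right_image T w))))"
    (is "?L \<longleftrightarrow> ?R")
  proof
    assume ?L
    then show ?R
      unfolding rel_le_iff set_of_comp by (simp flip: decode_set_of add: set_of_left_lift set_of_right_lift)
  next
    assume R: ?R
    show ?L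
    proof (intro allI)
      fix T and \<phi> :: "bool \<times> bool \<Rightarrow> bool"
      let ?w = "rel_of {p \<in> T. \<phi> p}"
      have "rel_le ?w (rel_of T)" by (auto simp: rel_le_iff)
      with R have "decode c T \<subseteq> decode c (set_of (left_image (rel_of T) ?w)) O decode c (set_of (right_image (rel_of T) ?w))"
        unfolding rel_le_iff set_of_comp by (simp add: decode_def)
      moreover have "set_of (left_image (rel_of T) ?w) = (\<lambda>p. (fst p, \<phi> p)) ` T"
        "set_of (right_image (rel_of T) ?w) = (\<lambda>p. (\<phi> p, snd p)) ` T"
        unfolding set_of_left_lift set_of_right_lift by (auto intro!: image_cong)
      ultimately show "decode c T \<subseteq> decode c ((\<lambda>p. (fst p, \<phi> p)) ` T) O decode c ((\<lambda>p. (\<phi> p, snd p)) ` T)"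
        by simp
    qed
  qed
  show ?thesis
    unfolding consistent_def consistent_code_def list_all_rels empty conv mono id lift by blast
qed

text \<open>The eight stored values determine a consistent map: symmetry supplies the values at the
  converses, and those at \<open>r1\<close>, \<open>r8\<close>, \<open>r9\<close> are diagonal and
  follow from the values possible at the first point.\<close>

lemma decode_encode:
  assumes v: "consistent v"
  shows "decode (encode v) = v"
proof
  fix T
  define w where "w = (\<lambda>r. rel_of (v (set_of r)))"
  have set_of_w: "set_of (w r) = v (set_of r)" for r by (simp add: w_def)
  have w_conv: "w (rel_conv r) = rel_conv (w r)" for r
  proof -
    have "set_of (w (rel_conv r)) = set_of (rel_conv (w r))"
      using v by (simp add: set_of_w set_of_conv consistent_def)
    then show ?thesis by (metis rel_of_set_of)
  qed
  have w_lift: "rel_le (w r) (rel_comp (w (left_image r u)) (w (right_image r u)))" for r u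
    using v unfolding rel_le_iff set_of_comp set_of_w set_of_left_lift set_of_right_lift
    by (simp add: consistent_def)
  have w_mono: "rel_le r s \<Longrightarrow> rel_le (w r) (w s)" for r s
    using v unfolding rel_le_iff set_of_w consistent_def by (blast dest: monoD)
  have w_id: "rel_le (w r9) r9"
    using v unfolding rel_le_iff set_of_w set_of_r9 consistent_def by blast
  have w_empty: "w r0 = r0"
  proof -
    have "w r0 = rel_of {}" unfolding w_def set_of_r0 using v by (simp add: consistent_def)
    then show ?thesis by (simp add: rel_of_def)
  qed
  \<comment> \<open>A value at the first point survives replacement of the second point. If
    \<open>u\<close> moves the columns of \<open>r\<close> into \<open>s\<close> in this way, and
    \<open>u'\<close> those of \<open>s\<close> into \<open>r\<close>, then \<open>w r\<close> and
    \<open>w s\<close> have the same first values, and \<open>w r\<close> is diagonal.\<close>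
  have w_diag: "w r = rel_diag (w s)" if "rel_le r r9" "rel_le (left_image r u) s" "rel_le (left_image s u') r" for r s u u'
  proof -
    have r: "set_of (w r) \<subseteq> Id"
      using w_mono[OF that(1)] w_id by (auto simp: rel_le_iff simp flip: set_of_r9)
    moreover have "set_of (w r) \<subseteq> set_of (w s) O UNIV"
      using w_lift[of r u] w_mono[OF that(2)] unfolding rel_le_iff set_of_comp by blast
    moreover have "set_of (w s) \<subseteq> set_of (w r) O UNIV"
      using w_lift[of s u'] w_mono[OF that(3)] unfolding rel_le_iff set_of_comp by blast
    ultimately have "set_of (w r) = set_of (rel_diag (w s))"
      unfolding set_of_diag by fast
    then show ?thesis by (metis rel_of_set_of)
  qed
  have "fam_at (encode v) r = w r" for r
  proof -
    \<comment> \<open>The columns in \<open>u\<close> and \<open>u'\<close> are those whose second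
      entry becomes 1.\<close>
    have "w r1 = rel_diag (w r2)" by (rule w_diag[where u = r1 and u' = r0]) simp_all
    moreover have "w r8 = rel_diag (w r4)" by (rule w_diag[where u = r0 and u' = r4]) simp_all
    moreover have "w r9 = rel_diag (w rB)" by (rule w_diag[where u = r8 and u' = r8]) simp_all
    moreover have "encode v = Fam (w r2) (w r3) (w rA) (w rB) (w r6) (w r7) (w rE) (w rF)"
      by (simp add: encode_def w_def Let_def del: set_of.simps)
    ultimately show ?thesis
      using w_empty w_conv[of r2] w_conv[of r3] w_conv[of rA] w_conv[of rB]
        w_conv[of r6] w_conv[of r7] w_conv[of rE] w_conv[of rF]
      by (cases r rule: rel_exhaust) simp_all
  qed
  then show "decode (encode v) T = v T"
    by (simp add: decode_def set_of_w)
qed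

section \<open>The 93 coded families\<close>

type_synonym constraint = "rel \<times> bool \<times> bool"

text \<open>The rows follow those of \<^const>\<open>table\<close>: the profile of \<open>K\<close>, then forbidden pairs defining
  \<open>K\<close>, \<open>C\<^sub>1\<^sup>K\<close> and \<open>C\<^sub>2\<^sup>K\<close>; \<open>(T, x, y)\<close> forbids the values \<open>x, y\<close> at points with columns in \<open>T\<close>.\<close>

definition coded_table :: "(fam \<times> constraint list \<times> constraint list \<times> constraint list) list" where
  "coded_table = [
    (Fam rF rF rF rF rF rF rF rF, [], [], []),
    (Fam rB rF rF rF rF rF rF rF, [(r2, True, False)], [(r1, True, True), (r8, False, False)], [(rB, True, False)]),
    (Fam rD rF rF rF rF rF rF rF, [(r2, False, True)], [(r1, True, True), (r8, False, False)], [(rB, True, False)]),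
    (Fam r7 rF rF rF rF rF rF rF, [(r2, True, True)], [(r1, True, True), (r8, False, False)], [(r7, True, True)]),
    (Fam rE rF rF rF rF rF rF rF, [(r2, False, False)], [(r1, True, True), (r8, False, False)], [(rE, False, False)]),
    (Fam r9 rF rF rF rF rF rF rF, [(r2, False, True), (r2, True, False)], [(r1, True, True), (r8, False, False)], []),
    (Fam r6 rF rF rF rF rF rF rF, [(r2, False, False), (r2, True, True)], [(r1, True, True), (r8, False, False)], [(r6, False, False), (r6, True, True)]),
    (Fam rB rB rF rF rF rF rF rF, [(r3, True, False)], [(r1, True, True)], [(rB, True, False)]),
    (Fam rD rD rF rF rF rF rF rF, [(r3, False, True)], [(r1, True, True)], [(rB, True, False)]),
    (Fam rD rF rD rF rF rF rF rF, [(rA, False, True)], [(r8, False, False)], [(rB, True, False)]),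
    (Fam rB rF rB rF rF rF rF rF, [(rA, True, False)], [(r8, False, False)], [(rB, True, False)]),
    (Fam r3 r3 rF rF rF rF rF rF, [(r1, True, True)], [(r1, True, True)], [(r1, True, True)]),
    (Fam rC rC rF rF rF rF rF rF, [(r1, False, False)], [(r1, True, True)], [(r8, False, False)]),
    (Fam r5 rF r5 rF rF rF rF rF, [(r8, True, True)], [(r8, False, False)], [(r1, True, True)]),
    (Fam rA rF rA rF rF rF rF rF, [(r8, False, False)], [(r8, False, False)], [(r8, False, False)]),
    (Fam r9 rB rD rF rF rF rF rF, [(r3, True, False), (rA, False, True)], [(r1, True, True), (r8, False, False)], [(rB, True, False)]),
    (Fam r9 rD rB rF rF rF rF rF, [(r3, False, True), (rA, True, False)], [(r1, True, True), (r8, False, False)], [(rB, True, False)]),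
    (Fam r1 r3 r5 rF rF rF rF rF, [(r1, True, True), (r8, True, True)], [(r1, True, True), (r8, False, False)], [(r1, True, True)]),
    (Fam r8 rC rA rF rF rF rF rF, [(r1, False, False), (r8, False, False)], [(r1, True, True), (r8, False, False)], [(r8, False, False)]),
    (Fam rB rB rB rF rF rF rF rF, [(r3, True, False), (rA, True, False)], [(r1, True, True), (r8, False, False)], [(rB, True, False)]),
    (Fam rD rD rD rF rF rF rF rF, [(r3, False, True), (rA, False, True)], [(r1, True, True), (r8, False, False)], [(rB, True, False)]),
    (Fam r3 r3 rB rF rF rF rF rF, [(r1, True, True), (rA, True, False)], [(r1, True, True), (r8, False, False)], [(rB, True, False), (r1, True, True)]),
    (Fam rC rC rD rF rF rF rF rF, [(r1, False, False), (rA, False, True)], [(r1, True, True), (r8, False, False)], [(rB, True, False), (r8, False, False)]),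
    (Fam rA rB rA rF rF rF rF rF, [(r8, False, False), (r3, True, False)], [(r1, True, True), (r8, False, False)], [(rB, True, False), (r8, False, False)]),
    (Fam r5 rD r5 rF rF rF rF rF, [(r8, True, True), (r3, False, True)], [(r1, True, True), (r8, False, False)], [(rB, True, False), (r1, True, True)]),
    (Fam r2 r3 rA rF rF rF rF rF, [(r1, True, True), (r8, False, False)], [(r1, True, True), (r8, False, False)], [(r1, True, True), (r8, False, False)]),
    (Fam r4 rC r5 rF rF rF rF rF, [(r1, False, False), (r8, True, True)], [(r1, True, True), (r8, False, False)], [(r1, True, True), (r8, False, False)]),
    (Fam r7 rF rF rF r7 rF rF rF, [(r6, True, True)], [(r6, False, False), (r6, True, True)], [(r7, True, True)]),
    (Fam rE rF rF rF rE rF rF rF, [(r6, False, False)], [(r6, False, False), (r6, True, True)], [(rE, False, False)]),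
    (Fam r6 rF rF rF r7 rF rF rF, [(r6, True, True), (r2, False, False), (r2, True, True)], [(r6, False, False), (r6, True, True), (r1, True, True), (r8, False, False)], [(r6, False, False), (r6, True, True), (rB, True, False)]),
    (Fam r6 rF rF rF rE rF rF rF, [(r6, False, False), (r2, False, False), (r2, True, True)], [(r6, False, False), (r6, True, True), (r1, True, True), (r8, False, False)], [(r6, False, False), (r6, True, True), (rB, True, False)]),
    (Fam r3 r3 rF rF r7 rF rF rF, [(r6, True, True), (r1, True, True)], [(r6, False, False), (r6, True, True), (r1, True, True), (r8, False, False)], [(r7, True, True)]),
    (Fam rC rC rF rF rE rF rF rF, [(r6, False, False), (r1, False, False)], [(r6, False, False), (r6, True, True), (r1, True, True), (r8, False, False)], [(rE, False, False)]),
    (Fam r5 rF r5 rF r7 rF rF rF, [(r6, True, True), (r8, True, True)], [(r6, False, False), (r6, True, True), (r1, True, True), (r8, False, False)], [(r7, True, True)]),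
    (Fam rA rF rA rF rE rF rF rF, [(r6, False, False), (r8, False, False)], [(r6, False, False), (r6, True, True), (r1, True, True), (r8, False, False)], [(rE, False, False)]),
    (Fam r3 r3 rB rF r7 rF rF rF, [(r6, True, True), (r1, True, True), (rA, True, False)], [(r6, False, False), (r6, True, True), (r1, True, True), (r8, False, False)], [(rB, True, False), (r7, True, True)]),
    (Fam rC rC rD rF rE rF rF rF, [(r6, False, False), (r1, False, False), (rA, False, True)], [(r6, False, False), (r6, True, True), (r1, True, True), (r8, False, False)], [(rB, True, False), (rE, False, False)]),
    (Fam r5 rD r5 rF r7 rF rF rF, [(r6, True, True), (r8, True, True), (r3, False, True)], [(r6, False, False), (r6, True, True), (r1, True, True), (r8, False, False)], [(rB, True, False), (r7, True, True)]),
    (Fam rA rB rA rF rE rF rF rF, [(r6, False, False), (r8, False, False), (r3, True, False)], [(r6, False, False), (r6, True, True), (r1, True, True), (r8, False, False)], [(rB, True, False), (rE, False, False)]),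
    (Fam r2 r3 rA rF r7 rF rF rF, [(r6, True, True), (r1, True, True), (r8, False, False)], [(r6, False, False), (r6, True, True), (r1, True, True), (r8, False, False)], [(r7, True, True), (r1, True, True), (r8, False, False)]),
    (Fam r4 rC r5 rF rE rF rF rF, [(r6, False, False), (r1, False, False), (r8, True, True)], [(r6, False, False), (r6, True, True), (r1, True, True), (r8, False, False)], [(rE, False, False), (r1, True, True), (r8, False, False)]),
    (Fam r4 rC r5 rF r7 rF rF rF, [(r6, True, True), (r1, False, False), (r8, True, True)], [(r6, False, False), (r6, True, True), (r1, True, True), (r8, False, False)], [(r7, True, True), (r1, True, True), (r8, False, False)]),
    (Fam r2 r3 rA rF rE rF rF rF, [(r6, False, False), (r1, True, True), (r8, False, False)], [(r6, False, False), (r6, True, True), (r1, True, True), (r8, False, False)], [(rE, False, False), (r1, True, True), (r8, False, False)]),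
    (Fam r1 r3 r5 rF r7 rF rF rF, [(r6, True, True), (r1, True, True), (r8, True, True)], [(r6, False, False), (r6, True, True), (r1, True, True), (r8, False, False)], [(r7, True, True)]),
    (Fam r8 rC rA rF rE rF rF rF, [(r6, False, False), (r1, False, False), (r8, False, False)], [(r6, False, False), (r6, True, True), (r1, True, True), (r8, False, False)], [(rE, False, False)]),
    (Fam r6 rF rF rF r6 rF rF rF, [(r6, False, False), (r6, True, True)], [(r6, False, False), (r6, True, True)], [(r6, False, False), (r6, True, True)]),
    (Fam r2 r3 rA rF r6 rF rF rF, [(r6, False, False), (r6, True, True), (r1, True, True), (r8, False, False)], [(r6, False, False), (r6, True, True), (r1, True, True), (r8, False, False)], [(r6, False, False), (r6, True, True), (r1, True, True), (r8, False, False)]),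
    (Fam r4 rC r5 rF r6 rF rF rF, [(r6, False, False), (r6, True, True), (r1, False, False), (r8, True, True)], [(r6, False, False), (r6, True, True), (r1, True, True), (r8, False, False)], [(r6, False, False), (r6, True, True), (r1, True, True), (r8, False, False)]),
    (Fam rB rB rB rB rF rF rF rF, [(rB, True, False)], [(rB, True, False)], [(rB, True, False)]),
    (Fam rD rD rD rD rF rF rF rF, [(rB, False, True)], [(rB, True, False)], [(rB, True, False)]),
    (Fam r3 r3 rB rB rF rF rF rF, [(rB, True, False), (r1, True, True)], [(rB, True, False), (r1, True, True)], [(rB, True, False), (r1, True, True)]),
    (Fam rC rC rD rD rF rF rF rF, [(rB, False, True), (r1, False, False)], [(rB, True, False), (r1, True, True)], [(rB, True, False), (r8, False, False)]),
    (Fam rA rB rA rB rF rF rF rF, [(rB, True, False), (r8, False, False)], [(rB, True, False), (r8, False, False)], [(rB, True, False), (r8, False, False)]),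
    (Fam r5 rD r5 rD rF rF rF rF, [(rB, False, True), (r8, True, True)], [(rB, True, False), (r8, False, False)], [(rB, True, False), (r1, True, True)]),
    (Fam r2 r3 rA rB rF rF rF rF, [(rB, True, False), (r1, True, True), (r8, False, False)], [(rB, True, False), (r1, True, True), (r8, False, False)], [(rB, True, False), (r1, True, True), (r8, False, False)]),
    (Fam r4 rC r5 rD rF rF rF rF, [(rB, False, True), (r1, False, False), (r8, True, True)], [(rB, True, False), (r1, True, True), (r8, False, False)], [(rB, True, False), (r1, True, True), (r8, False, False)]),
    (Fam r2 r3 rA rB r6 r7 rE rF, [(r6, False, False), (r6, True, True), (rB, True, False)], [(r6, False, False), (r6, True, True), (rB, True, False)], [(r6, False, False), (r6, True, True), (rB, True, False)]),
    (Fam r4 rC r5 rD r6 rE r7 rF, [(r6, True, True), (r6, False, False), (rB, False, True)], [(r6, False, False), (r6, True, True), (rB, True, False)], [(r6, False, False), (r6, True, True), (rB, True, False)]),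
    (Fam r3 r3 rF rF r7 r7 rF rF, [(r7, True, True)], [(r7, True, True)], [(r7, True, True)]),
    (Fam rC rC rF rF rE rE rF rF, [(r7, False, False)], [(r7, True, True)], [(rE, False, False)]),
    (Fam r3 r3 rB rF r7 r7 rF rF, [(r7, True, True), (r1, True, True), (rA, True, False)], [(r7, True, True), (r1, True, True), (r8, False, False)], [(rB, True, False), (r7, True, True)]),
    (Fam rC rC rD rF rE rE rF rF, [(r7, False, False), (r1, False, False), (rA, False, True)], [(r7, True, True), (r1, True, True), (r8, False, False)], [(rB, True, False), (rE, False, False)]),
    (Fam r2 r3 rA rF r7 r7 rF rF, [(r7, True, True), (r1, True, True), (r8, False, False)], [(r7, True, True), (r1, True, True), (r8, False, False)], [(r7, True, True), (r1, True, True), (r8, False, False)]),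
    (Fam r4 rC r5 rF rE rE rF rF, [(r7, False, False), (r1, False, False), (r8, True, True)], [(r7, True, True), (r1, True, True), (r8, False, False)], [(rE, False, False), (r1, True, True), (r8, False, False)]),
    (Fam r3 r3 rB rB r7 r7 rF rF, [(rB, True, False), (r7, True, True)], [(rB, True, False), (r7, True, True)], [(rB, True, False), (r7, True, True)]),
    (Fam rC rC rD rD rE rE rF rF, [(rB, False, True), (r7, False, False)], [(rB, True, False), (r7, True, True)], [(rB, True, False), (rE, False, False)]),
    (Fam r2 r3 rA rB r7 r7 rF rF, [(rB, True, False), (r7, True, True), (r1, True, True), (r8, False, False)], [(rB, True, False), (r7, True, True), (r1, True, True), (r8, False, False)], [(rB, True, False), (r7, True, True), (r1, True, True), (r8, False, False)]),
    (Fam r4 rC r5 rD rE rE rF rF, [(rB, False, True), (r7, False, False), (r1, False, False), (r8, True, True)], [(rB, True, False), (r7, True, True), (r1, True, True), (r8, False, False)], [(rB, True, False), (rE, False, False), (r1, True, True), (r8, False, False)]),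
    (Fam rA rF rA rF rE rF rE rF, [(rE, False, False)], [(rE, False, False)], [(rE, False, False)]),
    (Fam r5 rF r5 rF r7 rF r7 rF, [(rE, True, True)], [(rE, False, False)], [(r7, True, True)]),
    (Fam rA rB rA rF rE rF rE rF, [(rE, False, False), (r8, False, False), (r3, True, False)], [(rE, False, False), (r1, True, True), (r8, False, False)], [(rB, True, False), (rE, False, False)]),
    (Fam r5 rD r5 rF r7 rF r7 rF, [(rE, True, True), (r8, True, True), (r3, False, True)], [(rE, False, False), (r1, True, True), (r8, False, False)], [(rB, True, False), (r7, True, True)]),
    (Fam r2 r3 rA rF rE rF rE rF, [(rE, False, False), (r1, True, True), (r8, False, False)], [(rE, False, False), (r1, True, True), (r8, False, False)], [(rE, False, False), (r1, True, True), (r8, False, False)]),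
    (Fam r4 rC r5 rF r7 rF r7 rF, [(rE, True, True), (r1, False, False), (r8, True, True)], [(rE, False, False), (r1, True, True), (r8, False, False)], [(r7, True, True), (r1, True, True), (r8, False, False)]),
    (Fam rA rB rA rB rE rF rE rF, [(rB, True, False), (rE, False, False)], [(rB, True, False), (rE, False, False)], [(rB, True, False), (rE, False, False)]),
    (Fam r5 rD r5 rD r7 rF r7 rF, [(rB, False, True), (rE, True, True)], [(rB, True, False), (rE, False, False)], [(rB, True, False), (r7, True, True)]),
    (Fam r2 r3 rA rB rE rF rE rF, [(rB, True, False), (rE, False, False), (r1, True, True), (r8, False, False)], [(rB, True, False), (rE, False, False), (r1, True, True), (r8, False, False)], [(rB, True, False), (rE, False, False), (r1, True, True), (r8, False, False)]),
    (Fam r4 rC r5 rD r7 rF r7 rF, [(rB, False, True), (rE, True, True), (r1, False, False), (r8, True, True)], [(rB, True, False), (rE, False, False), (r1, True, True), (r8, False, False)], [(rB, True, False), (r7, True, True), (r1, True, True), (r8, False, False)]),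
    (Fam r1 r3 r5 rF r7 r7 rF rF, [(r7, True, True), (r1, True, True), (r8, True, True)], [(r7, True, True), (r1, True, True), (r8, False, False)], [(r7, True, True)]),
    (Fam r8 rC rA rF rE rE rF rF, [(r7, False, False), (r1, False, False), (r8, False, False)], [(r7, True, True), (r1, True, True), (r8, False, False)], [(rE, False, False)]),
    (Fam r8 rC rA rF rE rF rE rF, [(rE, False, False), (r1, False, False), (r8, False, False)], [(rE, False, False), (r1, True, True), (r8, False, False)], [(rE, False, False)]),
    (Fam r1 r3 r5 rF r7 rF r7 rF, [(rE, True, True), (r1, True, True), (r8, True, True)], [(rE, False, False), (r1, True, True), (r8, False, False)], [(r7, True, True)]),
    (Fam r1 r3 r5 rF r7 r7 r7 rF, [(r7, True, True), (rE, True, True)], [(r6, False, False), (r6, True, True), (rB, True, False)], [(r7, True, True)]),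
    (Fam r8 rC rA rF rE rE rE rF, [(rE, False, False), (r7, False, False)], [(r6, False, False), (r6, True, True), (rB, True, False)], [(rE, False, False)]),
    (Fam r9 rF rF rF r9 rF rF rF, [(r6, False, True)], [(r6, False, False), (r6, True, True)], []),
    (Fam r9 rB rD rF r9 rF rF rF, [(r6, False, True), (r3, True, False), (rA, False, True)], [(r6, False, False), (r6, True, True), (r1, True, True), (r8, False, False)], [(rB, True, False)]),
    (Fam r9 rD rB rF r9 rF rF rF, [(r6, False, True), (r3, False, True), (rA, True, False)], [(r6, False, False), (r6, True, True), (r1, True, True), (r8, False, False)], [(rB, True, False)]),
    (Fam r1 r3 r5 rF r9 rF rF rF, [(r6, False, True), (r1, True, True), (r8, True, True)], [(r6, False, False), (r6, True, True), (r1, True, True), (r8, False, False)], [(r1, True, True)]),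
    (Fam r8 rC rA rF r9 rF rF rF, [(r6, False, True), (r1, False, False), (r8, False, False)], [(r6, False, False), (r6, True, True), (r1, True, True), (r8, False, False)], [(r8, False, False)]),
    (Fam r9 r9 r9 r9 r9 r9 r9 r9, [(rF, False, True)], [], []),
    (Fam r1 r1 r1 r1 r1 r1 r1 r1, [(rF, True, True)], [], [(r1, True, True)]),
    (Fam r8 r8 r8 r8 r8 r8 r8 r8, [(rF, False, False)], [], [(r8, False, False)]),
    (Fam r0 r0 r0 r0 r0 r0 r0 r0, [(rF, False, False), (rF, True, True)], [], [])]"

section \<open>Finite checks on the coded families\<close>

definition codes :: "fam list" where
  "codes = map fst coded_table"

fun fam_avoids :: "fam \<Rightarrow> constraint list \<Rightarrow> bool" where
  "fam_avoids c [] \<longleftrightarrow> True"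
| "fam_avoids c ((T, x, y) # G) \<longleftrightarrow> \<not> rel_mem (fam_at c T) x y \<and> fam_avoids c G"

definition equivalent :: "constraint list \<Rightarrow> constraint list \<Rightarrow> bool" where
  "equivalent G H \<longleftrightarrow> list_all (\<lambda>c. fam_avoids c G = fam_avoids c H) codes"

definition all_constraints :: "constraint list" where
  "all_constraints = [(T, x, y). T \<leftarrow> rels, x \<leftarrow> [False, True], y \<leftarrow> [False, True]]"

text \<open>The full lists of constraints computed from a family are the yardstick for the short
  lists written in \<open>coded_table\<close>.\<close>

definition own_list :: "fam \<Rightarrow> constraint list" where
  "own_list c = filter (\<lambda>(T, x, y). \<not> rel_mem (fam_at c T) x y) all_constraints"

definition right_list :: "fam \<Rightarrow> constraint list" where
  "right_list c = filter (\<lambda>(T, x, y). \<not> rel_le (fam_at c (rel_ins T x y)) (fam_at c T)) all_constraints"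

definition left_list :: "fam \<Rightarrow> constraint list" where
  "left_list c = map (\<lambda>(T, p). (fam_at c T, p)) (own_list c)"

lemma distinct_codes: "distinct codes"
  by code_simp

lemma length_codes: "length codes = 93"
  by code_simp

lemma codes_consistent: "list_all consistent_code codes"
  by code_simp

text \<open>A check on the 93 families alone, which \<open>avoiding_cong\<close> turns into equality
  of classes; the next two lemmas serve the two clones in the same way.\<close>

lemma coded_table_own: "list_all (\<lambda>(c, G, _, _). equivalent G (own_list c)) coded_table"
  by code_simp

lemma coded_table_right: "list_all (\<lambda>(c, _, G, _). equivalent G (right_list c)) coded_table"
  by code_simp

lemma coded_table_left: "list_all (\<lambda>(c, _, _, G). equivalent G (left_list c)) coded_table"
  by code_simp

text \<open>The relations equal to their converse. By symmetry they are the only possible values at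
  \<open>r6\<close>, \<open>r7\<close>, \<open>rE\<close>, \<open>rF\<close>, which halves four of
  the eight ranges of the search.\<close>

definition symmetric_rels :: "rel list" where
  "symmetric_rels = [r0, r1, r6, r7, r8, r9, rE, rF]"

text \<open>The instances of consistency used here are just those needed to leave no more than the 93
  families, each placed as early in the search as its arguments allow.\<close>

lemma enumeration:
  "list_all (\<lambda>c2. list_all (\<lambda>c3. \<not> (rel_le (rel_diag c2) c3 \<and> rel_le c2 c3) \<or>
   list_all (\<lambda>cA. \<not> (rel_le c2 cA \<and> rel_le (rel_diag (rel_conv c2)) cA
       \<and> rel_le (rel_conv cA) (rel_comp (rel_conv c2) c3) \<and> rel_le (rel_conv c3) (rel_comp cA (rel_conv c2))) \<or>
   list_all (\<lambda>c6. \<not> (rel_le c2 c6 \<and> rel_le c6 (rel_comp (rel_conv c3) c3)) \<or>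
   list_all (\<lambda>cB. \<not> (rel_le c3 cB \<and> rel_le cA cB \<and> rel_le (rel_diag cB) cB \<and> rel_le cB (rel_comp (rel_conv c3) c3)) \<or>
   list_all (\<lambda>c7. \<not> (rel_le c3 c7 \<and> rel_le c6 c7 \<and> rel_le cB (rel_comp c7 c6) \<and> rel_le c7 (rel_comp c6 (rel_conv cB))) \<or>
   list_all (\<lambda>cE. \<not> (rel_le c6 cE \<and> rel_le cA cE \<and> rel_le cE (rel_comp (rel_conv cB) c6) \<and> rel_le (rel_conv cB) (rel_comp cE c6)) \<or>
   list_all (\<lambda>cF. \<not> (rel_le cB cF \<and> rel_le cF (rel_comp (rel_conv cB) cB)) \<or>
     List.member codes (Fam c2 c3 cA cB c6 c7 cE cF))
   symmetric_rels) symmetric_rels) symmetric_rels) rels) symmetric_rels) rels) rels) rels"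
  by code_simp

section \<open>From codes to classes\<close>

definition avoiding :: "constraint list \<Rightarrow> bool_class" where
  "avoiding G = excluding ((\<lambda>(T, p). (set_of T, p)) ` set G)"

lemma fam_avoids_iff: "fam_avoids c G \<longleftrightarrow> (\<forall>(T, p)\<in>set G. p \<notin> decode c (set_of T))"
  by (induction c G rule: fam_avoids.induct) (auto simp: rel_mem_iff)

lemma mem_all_constraints: "g \<in> set all_constraints"
proof (cases g)
  case (fields T x y)
  then show ?thesis by (cases x; cases y) (auto simp: all_constraints_def set_rels)
qed

lemma conv_fixed: "rel_conv r = r \<Longrightarrow> r \<in> set symmetric_rels"
  by (cases r rule: rel_exhaust) (simp_all add: symmetric_rels_def)

lemma consistent_code_in_codes:
  assumes "consistent_code c"
  shows "c \<in> set codes"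
proof -
  obtain c2 c3 cA cB c6 c7 cE cF where c: "c = Fam c2 c3 cA cB c6 c7 cE cF" by (cases c)
  have sym: "rel_conv (fam_at c T) = fam_at c (rel_conv T)" for T
    using assms by (simp add: consistent_code_def)
  have mono: "rel_le T T' \<Longrightarrow> rel_le (fam_at c T) (fam_at c T')" for T T'
    using assms by (simp add: consistent_code_def)
  have lift: "rel_le w T \<Longrightarrow> rel_le (fam_at c T) (rel_comp (fam_at c (left_image T w)) (fam_at c (right_image T w)))" for T w
    using assms by (simp add: consistent_code_def)
  have "rel_conv c6 = c6" "rel_conv c7 = c7" "rel_conv cE = cE" "rel_conv cF = cF"
    using sym[of r6] sym[of r7] sym[of rE] sym[of rF] by (simp_all add: c)
  then have symm: "c6 \<in> set symmetric_rels" "c7 \<in> set symmetric_rels"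
      "cE \<in> set symmetric_rels" "cF \<in> set symmetric_rels"
    by (simp_all add: conv_fixed)
  have mono_facts: "rel_le (rel_diag c2) c3" "rel_le c2 c3" "rel_le c2 cA" "rel_le (rel_diag (rel_conv c2)) cA" "rel_le c2 c6" "rel_le c3 cB"
     "rel_le cA cB" "rel_le (rel_diag cB) cB" "rel_le c3 c7" "rel_le c6 c7" "rel_le c6 cE" "rel_le cA cE" "rel_le cB cF"
    using mono[of r1 r3] mono[of r2 r3] mono[of r2 rA] mono[of r8 rA] mono[of r2 r6] mono[of r3 rB]
      mono[of rA rB] mono[of r9 rB] mono[of r3 r7] mono[of r6 r7] mono[of r6 rE] mono[of rA rE] mono[of rB rF]
    by (simp_all add: c)
  \<comment> \<open>The third points used are, in turn, the all-zero point, the all-one point, the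
    complement of one of the two points, and their meet.\<close>
  have lift_facts: "rel_le (rel_conv cA) (rel_comp (rel_conv c2) c3)" "rel_le (rel_conv c3) (rel_comp cA (rel_conv c2))" "rel_le c6 (rel_comp (rel_conv c3) c3)"
     "rel_le cB (rel_comp (rel_conv c3) c3)" "rel_le cB (rel_comp c7 c6)" "rel_le c7 (rel_comp c6 (rel_conv cB))" "rel_le cE (rel_comp (rel_conv cB) c6)"
     "rel_le (rel_conv cB) (rel_comp cE c6)" "rel_le cF (rel_comp (rel_conv cB) cB)"
    using lift[of r0 rC] lift[of r5 r5] lift[of r0 r6] lift[of r0 rB] lift[of r1 rB] lift[of r3 r7]
      lift[of r4 rE] lift[of r5 rD] lift[of r8 rF]
    by (simp_all add: c)
  show ?thesis
    using enumeration symm mono_facts lift_facts unfolding list_all_iff set_rels List.member_iff c by blast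
qed

lemma consistent_iff: "consistent v \<longleftrightarrow> v \<in> decode ` set codes"
proof
  assume v: "consistent v"
  then have "consistent_code (encode v)" by (simp add: decode_encode flip: consistent_decode_iff)
  then have "decode (encode v) \<in> decode ` set codes" by (intro imageI consistent_code_in_codes)
  then show "v \<in> decode ` set codes" by (simp add: decode_encode v)
next
  assume "v \<in> decode ` set codes"
  then show "consistent v" using codes_consistent by (auto simp: consistent_decode_iff list_all_iff)
qed

lemma consistent_decode: "c \<in> set codes \<Longrightarrow> consistent (decode c)"
  by (simp add: consistent_iff)

lemma preserving_decode_subset_iff:
  "c \<in> set codes \<Longrightarrow> preserving (decode c) \<subseteq> avoiding G \<longleftrightarrow> fam_avoids c G"
  unfolding avoiding_def fam_avoids_iff
  by (subst preserving_subset_excluding_iff) (auto simp: consistent_decode profile_preserving)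

text \<open>A class given by forbidden pairs is stable, hence equal to
  \<open>preserving (decode c)\<close> for one of the 93 codes; the hypothesis is applied to this
  \<open>c\<close>.\<close>

lemma avoiding_subsetI:
  assumes "\<And>c. c \<in> set codes \<Longrightarrow> fam_avoids c G \<Longrightarrow> fam_avoids c H"
  shows "avoiding G \<subseteq> avoiding H"
proof -
  have "stable_class \<J> \<S>\<M> (avoiding G)" unfolding avoiding_def by (rule excluding_stable)
  then obtain v where v: "consistent v" "avoiding G = preserving v"
    using stable_classes_eq by blast
  then obtain c where c: "c \<in> set codes" "v = decode c" by (auto simp: consistent_iff)
  then have "fam_avoids c G" using v preserving_decode_subset_iff[OF c(1), of G] by simp
  then show ?thesis using assms c v preserving_decode_subset_iff[OF c(1), of H] by simp
qed

lemma avoiding_cong: "equivalent G H \<Longrightarrow> avoiding G = avoiding H"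
  by (intro equalityI avoiding_subsetI) (auto simp: equivalent_def list_all_iff)

lemma avoiding_own:
  assumes "c \<in> set codes"
  shows "avoiding (own_list c) = preserving (decode c)"
proof -
  have "(\<lambda>(T, p). (set_of T, p)) ` set (own_list c) = {(T, p). p \<notin> decode c T}"
  proof (intro set_eqI iffI)
    fix g assume "g \<in> {(T, p). p \<notin> decode c T}"
    then show "g \<in> (\<lambda>(T, p). (set_of T, p)) ` set (own_list c)"
      by (intro image_eqI[of _ _ "(rel_of (fst g), snd g)"])
        (auto simp: own_list_def mem_all_constraints rel_mem_iff decode_def)
  qed (auto simp: own_list_def rel_mem_iff)
  then show ?thesis
    using consistent_decode[OF assms] by (simp add: avoiding_def preserving_eq_excluding consistent_def)
qed

lemma avoiding_right: "avoiding (right_list c) = excluding (right_constraints (decode c))"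
proof -
  have "(\<lambda>(T, p). (set_of T, p)) ` set (right_list c) = right_constraints (decode c)"
  proof (intro set_eqI iffI)
    fix g assume "g \<in> right_constraints (decode c)"
    then show "g \<in> (\<lambda>(T, p). (set_of T, p)) ` set (right_list c)"
      by (intro image_eqI[of _ _ "(rel_of (fst g), snd g)"])
        (auto simp: right_list_def mem_all_constraints rel_le_iff right_constraints_def
          simp flip: decode_set_of simp: set_of_ins)
  qed (auto simp: right_list_def rel_le_iff right_constraints_def simp flip: decode_set_of simp: set_of_ins)
  then show ?thesis by (simp add: avoiding_def)
qed

lemma avoiding_left: "avoiding (left_list c) = excluding (left_constraints (decode c))"
proof -
  have "(\<lambda>(T, p). (set_of T, p)) ` set (left_list c) = left_constraints (decode c)"
  proof (intro set_eqI iffI)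
    fix g assume "g \<in> left_constraints (decode c)"
    then obtain T p where g: "g = (decode c T, p)" "p \<notin> decode c T"
      by (auto simp: left_constraints_def)
    then have "(rel_of T, p) \<in> set (own_list c)"
      by (cases p) (auto simp: own_list_def mem_all_constraints rel_mem_iff decode_def)
    then show "g \<in> (\<lambda>(T, p). (set_of T, p)) ` set (left_list c)"
      using g by (force simp: left_list_def decode_def)
  qed (force simp: left_list_def own_list_def rel_mem_iff left_constraints_def simp flip: decode_set_of)
  then show ?thesis by (simp add: avoiding_def)
qed

lemma coded_table_classes:
  assumes "(c, G, G1, G2) \<in> set coded_table"
  shows "c \<in> set codes" "avoiding G = preserving (decode c)"
    "avoiding G1 = excluding (right_constraints (decode c))"
    "avoiding G2 = excluding (left_constraints (decode c))"
proof -
  show c: "c \<in> set codes" using assms by (force simp: codes_def)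
  show "avoiding G = preserving (decode c)"
    using coded_table_own assms avoiding_own[OF c] by (auto simp: list_all_iff dest!: bspec[OF _ assms] avoiding_cong)
  show "avoiding G1 = excluding (right_constraints (decode c))"
    using coded_table_right assms avoiding_right by (auto simp: list_all_iff dest!: bspec[OF _ assms] avoiding_cong)
  show "avoiding G2 = excluding (left_constraints (decode c))"
    using coded_table_left assms avoiding_left by (auto simp: list_all_iff dest!: bspec[OF _ assms] avoiding_cong)
qed

lemma stable_classes_coded_table: "{K. stable_class \<J> \<S>\<M> K} = (\<lambda>(c, G, _). avoiding G) ` set coded_table"
proof -
  have "{v. consistent v} = decode ` set codes" by (auto simp: consistent_iff)
  also have "\<dots> = (\<lambda>(c, _). decode c) ` set coded_table"
    by (simp add: codes_def image_image case_prod_unfold)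
  finally have "{v. consistent v} = (\<lambda>(c, _). decode c) ` set coded_table" .
  then have "{K. stable_class \<J> \<S>\<M> K} = (\<lambda>(c, _). preserving (decode c)) ` set coded_table"
    unfolding stable_classes_eq by (simp add: image_image case_prod_unfold)
  also have "\<dots> = (\<lambda>(c, G, _). avoiding G) ` set coded_table"
    by (intro image_cong refl) (auto simp: coded_table_classes(2))
  finally show ?thesis .
qed

lemma card_stable_classes: "card {K. stable_class \<J> \<S>\<M> K} = 93"
proof -
  have "card {K. stable_class \<J> \<S>\<M> K} = card {v. consistent v}"
    unfolding stable_classes_eq by (rule card_image[OF inj_on_preserving])
  also have "{v. consistent v} = decode ` set codes" by (auto simp: consistent_iff)
  also have "card \<dots> = card (set codes)"
    by (intro card_image inj_on_inverseI[of _ encode] encode_decode)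
  also have "\<dots> = 93" using distinct_codes length_codes by (simp add: distinct_card)
  finally show ?thesis .
qed

section \<open>The classes of the table\<close>

text \<open>A single constraint on a single function, spelled out over points so that it can be
  compared with the definitions of the named classes.\<close>

definition avoids :: "bool_fun \<Rightarrow> rel \<Rightarrow> bool \<Rightarrow> bool \<Rightarrow> bool" where
  "avoids f T x y \<longleftrightarrow> (\<forall>a\<in>dom_of f. \<forall>b\<in>dom_of f. set (zip a b) \<subseteq> set_of T \<longrightarrow> \<not> (val f a = x \<and> val f b = y))"

lemma avoids_iff: "avoids f T x y \<longleftrightarrow> (x, y) \<notin> profile {f} (set_of T)"
  unfolding avoids_def profile_def by blast

lemma mem_avoiding_Nil: "f \<in> avoiding [] \<longleftrightarrow> f \<in> \<Omega>"
  by (simp add: avoiding_def excluding_def)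

lemma mem_avoiding_Cons: "f \<in> avoiding ((T, x, y) # G) \<longleftrightarrow> avoids f T x y \<and> f \<in> avoiding G"
  by (auto simp: avoiding_def excluding_def avoids_iff)

lemma mem_avoiding_iff: "f \<in> avoiding G \<longleftrightarrow> f \<in> \<Omega> \<and> (\<forall>(T, x, y)\<in>set G. avoids f T x y)"
  by (auto simp: avoiding_def excluding_def avoids_iff)

lemma avoiding_append: "avoiding (G @ H) = avoiding G \<inter> avoiding H"
  by (auto simp: mem_avoiding_iff)

lemmas mem_avoiding = mem_avoiding_Nil mem_avoiding_Cons

section \<open>Forbidden pairs as conditions on points\<close>

lemma zip_subset_iff:
  "length a = length b \<Longrightarrow> set (zip a b) \<subseteq> T \<longleftrightarrow> (\<forall>i<length b. (a ! i, b ! i) \<in> T)"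
  by (auto simp: set_zip)

lemma zip_subset_rels:
  assumes "length a = n" "length b = n"
  shows "set (zip a b) \<subseteq> set_of r1 \<longleftrightarrow> a = zeros n \<and> b = zeros n"
    and "set (zip a b) \<subseteq> set_of r2 \<longleftrightarrow> a = zeros n \<and> b = ones n"
    and "set (zip a b) \<subseteq> set_of r8 \<longleftrightarrow> a = ones n \<and> b = ones n"
    and "set (zip a b) \<subseteq> set_of r3 \<longleftrightarrow> a = zeros n"
    and "set (zip a b) \<subseteq> set_of rA \<longleftrightarrow> b = ones n"
    and "set (zip a b) \<subseteq> set_of r6 \<longleftrightarrow> b = tuple_compl a"
    and "set (zip a b) \<subseteq> set_of rB \<longleftrightarrow> tuple_le a b"
    and "set (zip a b) \<subseteq> set_of r7 \<longleftrightarrow> meet a b = zeros n"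
    and "set (zip a b) \<subseteq> set_of rE \<longleftrightarrow> join a b = ones n"
  using assms
  by (auto simp: zip_subset_iff list_eq_iff_nth_eq zeros_def ones_def tuple_compl_def tuple_le_def
      meet_def join_def list_all2_conv_all_nth)

lemma zeros_in_cube [simp]: "zeros n \<in> cube n" and ones_in_cube [simp]: "ones n \<in> cube n"
  by (simp_all add: zeros_def ones_def cube_def)

lemma tuple_compl_in_cube [simp]: "tuple_compl a \<in> cube n \<longleftrightarrow> a \<in> cube n"
  by (simp add: tuple_compl_def cube_def)

lemma tuple_compl_tuple_compl [simp]: "tuple_compl (tuple_compl a) = a"
  by (simp add: tuple_compl_def comp_def)

lemma avoids_iffs:
  "avoids f r1 x y \<longleftrightarrow> \<not> (at0 f = x \<and> at0 f = y)"
  "avoids f r8 x y \<longleftrightarrow> \<not> (at1 f = x \<and> at1 f = y)"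
  "avoids f r2 x y \<longleftrightarrow> \<not> (at0 f = x \<and> at1 f = y)"
  "avoids f r3 x y \<longleftrightarrow> (at0 f = x \<longrightarrow> (\<forall>b\<in>dom_of f. val f b \<noteq> y))"
  "avoids f rA x y \<longleftrightarrow> (at1 f = y \<longrightarrow> (\<forall>a\<in>dom_of f. val f a \<noteq> x))"
  "avoids f r6 x y \<longleftrightarrow> (\<forall>a\<in>dom_of f. \<not> (val f a = x \<and> val f (tuple_compl a) = y))"
  "avoids f rB x y \<longleftrightarrow> (\<forall>a\<in>dom_of f. \<forall>b\<in>dom_of f. tuple_le a b \<longrightarrow> \<not> (val f a = x \<and> val f b = y))"
  "avoids f r7 x y \<longleftrightarrow> (\<forall>a\<in>dom_of f. \<forall>b\<in>dom_of f. meet a b = zeros (arity f) \<longrightarrow> \<not> (val f a = x \<and> val f b = y))"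
  "avoids f rE x y \<longleftrightarrow> (\<forall>a\<in>dom_of f. \<forall>b\<in>dom_of f. join a b = ones (arity f) \<longrightarrow> \<not> (val f a = x \<and> val f b = y))"
  "avoids f rF x y \<longleftrightarrow> (\<forall>a\<in>dom_of f. \<forall>b\<in>dom_of f. \<not> (val f a = x \<and> val f b = y))"
proof -
  have avoids: "avoids f T x y \<longleftrightarrow> (\<forall>a\<in>dom_of f. \<forall>b\<in>dom_of f. P a b \<longrightarrow> \<not> (val f a = x \<and> val f b = y))"
    if "\<And>a b. length a = arity f \<Longrightarrow> length b = arity f \<Longrightarrow> set (zip a b) \<subseteq> set_of T \<longleftrightarrow> P a b" for T P
    using that unfolding avoids_def cube_def by auto
  have rels:
    "avoids f r1 x y \<longleftrightarrow> (\<forall>a\<in>dom_of f. \<forall>b\<in>dom_of f. a = zeros (arity f) \<and> b = zeros (arity f) \<longrightarrow> \<not> (val f a = x \<and> val f b = y))"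
    "avoids f r8 x y \<longleftrightarrow> (\<forall>a\<in>dom_of f. \<forall>b\<in>dom_of f. a = ones (arity f) \<and> b = ones (arity f) \<longrightarrow> \<not> (val f a = x \<and> val f b = y))"
    "avoids f r2 x y \<longleftrightarrow> (\<forall>a\<in>dom_of f. \<forall>b\<in>dom_of f. a = zeros (arity f) \<and> b = ones (arity f) \<longrightarrow> \<not> (val f a = x \<and> val f b = y))"
    "avoids f r3 x y \<longleftrightarrow> (\<forall>a\<in>dom_of f. \<forall>b\<in>dom_of f. a = zeros (arity f) \<longrightarrow> \<not> (val f a = x \<and> val f b = y))"
    "avoids f rA x y \<longleftrightarrow> (\<forall>a\<in>dom_of f. \<forall>b\<in>dom_of f. b = ones (arity f) \<longrightarrow> \<not> (val f a = x \<and> val f b = y))"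
    "avoids f r6 x y \<longleftrightarrow> (\<forall>a\<in>dom_of f. \<forall>b\<in>dom_of f. b = tuple_compl a \<longrightarrow> \<not> (val f a = x \<and> val f b = y))"
    by (rule avoids, erule (1) zip_subset_rels)+
  show "avoids f r1 x y \<longleftrightarrow> \<not> (at0 f = x \<and> at0 f = y)"
    "avoids f r8 x y \<longleftrightarrow> \<not> (at1 f = x \<and> at1 f = y)"
    "avoids f r2 x y \<longleftrightarrow> \<not> (at0 f = x \<and> at1 f = y)"
    "avoids f r3 x y \<longleftrightarrow> (at0 f = x \<longrightarrow> (\<forall>b\<in>dom_of f. val f b \<noteq> y))"
    "avoids f rA x y \<longleftrightarrow> (at1 f = y \<longrightarrow> (\<forall>a\<in>dom_of f. val f a \<noteq> x))"
    "avoids f r6 x y \<longleftrightarrow> (\<forall>a\<in>dom_of f. \<not> (val f a = x \<and> val f (tuple_compl a) = y))"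
    unfolding rels at0_def at1_def using zeros_in_cube ones_in_cube by (auto simp del: set_of.simps)
  show "avoids f rB x y \<longleftrightarrow> (\<forall>a\<in>dom_of f. \<forall>b\<in>dom_of f. tuple_le a b \<longrightarrow> \<not> (val f a = x \<and> val f b = y))"
    "avoids f r7 x y \<longleftrightarrow> (\<forall>a\<in>dom_of f. \<forall>b\<in>dom_of f. meet a b = zeros (arity f) \<longrightarrow> \<not> (val f a = x \<and> val f b = y))"
    "avoids f rE x y \<longleftrightarrow> (\<forall>a\<in>dom_of f. \<forall>b\<in>dom_of f. join a b = ones (arity f) \<longrightarrow> \<not> (val f a = x \<and> val f b = y))"
    by (rule avoids, erule (1) zip_subset_rels)+
  show "avoids f rF x y \<longleftrightarrow> (\<forall>a\<in>dom_of f. \<forall>b\<in>dom_of f. \<not> (val f a = x \<and> val f b = y))"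
    unfolding avoids_def by auto
qed

section \<open>Named classes, subscripts and negation\<close>

lemma basic_classes:
  "\<Omega> = avoiding []"
  "\<C> = avoiding [(rF, False, True)]"
  "\<C>0 = avoiding [(rF, True, True)]"
  "\<C>1 = avoiding [(rF, False, False)]"
  "\<M> = avoiding [(rB, True, False)]"
  "\<S> = avoiding [(r6, False, False), (r6, True, True)]"
  "\<R> = avoiding [(r6, False, True)]"
  "\<U>2 = avoiding [(r7, True, True)]"
  "\<W>2 = avoiding [(rE, False, False)]"
proof -
  show "\<Omega> = avoiding []" by (auto simp: mem_avoiding)
  show "\<C> = avoiding [(rF, False, True)]"
    by (intro set_eqI) (simp add: \<C>_def mem_avoiding avoids_iffs, blast)
  show "\<C>0 = avoiding [(rF, True, True)]" "\<C>1 = avoiding [(rF, False, False)]" "\<M> = avoiding [(rB, True, False)]"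
    "\<U>2 = avoiding [(r7, True, True)]"
    by (auto simp: \<C>0_def \<C>1_def \<M>_def \<U>2_def mem_avoiding avoids_iffs)
  show "\<W>2 = avoiding [(rE, False, False)]"
    by (intro set_eqI) (simp add: \<W>2_def mem_avoiding avoids_iffs, blast)
  show "\<S> = avoiding [(r6, False, False), (r6, True, True)]"
    by (intro set_eqI) (simp add: \<S>_def mem_avoiding avoids_iffs, blast)
  show "\<R> = avoiding [(r6, False, True)]"
  proof (intro set_eqI)
    fix f
    show "f \<in> \<R> \<longleftrightarrow> f \<in> avoiding [(r6, False, True)]"
      unfolding \<R>_def mem_avoiding avoids_iffs mem_Collect_eq
      \<comment> \<open>Forbidding the values 0, 1 at \<open>a\<close> and its complement also
        forbids 1, 0: the roles of the two points are exchanged.\<close>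
      by (metis tuple_compl_in_cube tuple_compl_tuple_compl)
  qed
qed

text \<open>Taking the all-zero point twice, the two forbidden pairs exclude both values
  there.\<close>

lemma empty_class: "{} = avoiding [(rF, False, False), (rF, True, True)]"
proof -
  have "f \<notin> avoiding [(rF, False, False), (rF, True, True)]" for f
    unfolding mem_avoiding avoids_iffs using zeros_in_cube by (metis (full_types))
  then show ?thesis by blast
qed

lemma Int_classes: "avoiding G \<inter> avoiding H = avoiding (G @ H)"
  by (simp add: avoiding_append)

lemma sub_classes:
  "(avoiding G)\<^bsub>0*\<^esub> = avoiding (G @ [(r1, True, True)])"
  "(avoiding G)\<^bsub>1*\<^esub> = avoiding (G @ [(r1, False, False)])"
  "(avoiding G)\<^bsub>*0\<^esub> = avoiding (G @ [(r8, True, True)])"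
  "(avoiding G)\<^bsub>*1\<^esub> = avoiding (G @ [(r8, False, False)])"
  "(avoiding G)\<^bsub>00\<^esub> = avoiding (G @ [(r1, True, True), (r8, True, True)])"
  "(avoiding G)\<^bsub>01\<^esub> = avoiding (G @ [(r1, True, True), (r8, False, False)])"
  "(avoiding G)\<^bsub>10\<^esub> = avoiding (G @ [(r1, False, False), (r8, True, True)])"
  "(avoiding G)\<^bsub>11\<^esub> = avoiding (G @ [(r1, False, False), (r8, False, False)])"
  "(avoiding G)\<^bsub>=\<^esub> = avoiding (G @ [(r2, False, True), (r2, True, False)])"
  "(avoiding G)\<^bsub>\<noteq>\<^esub> = avoiding (G @ [(r2, False, False), (r2, True, True)])"
  "(avoiding G)\<^bsub>\<le>\<^esub> = avoiding (G @ [(r2, True, False)])"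
  "(avoiding G)\<^bsub>\<ge>\<^esub> = avoiding (G @ [(r2, False, True)])"
  "(avoiding G)\<^bsub>\<noteq>,00\<^esub> = avoiding (G @ [(r2, True, True)])"
  "(avoiding G)\<^bsub>\<noteq>,11\<^esub> = avoiding (G @ [(r2, False, False)])"
  by (auto simp: mem_avoiding_iff avoids_iffs sub_0any_def sub_1any_def sub_any0_def sub_any1_def sub_00_def sub_01_def
      sub_10_def sub_11_def sub_eq_def sub_neq_def sub_le_def sub_ge_def sub_neq_00_def sub_neq_11_def)

lemma neg_fun_in_Omega: "f \<in> \<Omega> \<Longrightarrow> neg_fun f \<in> \<Omega>"
  by (simp add: \<Omega>_def neg_fun_def)

lemma arity_neg_fun [simp]: "arity (neg_fun f) = arity f"
  by (simp add: neg_fun_def)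

lemma val_neg_fun [simp]: "a \<in> dom_of f \<Longrightarrow> val (neg_fun f) a \<longleftrightarrow> \<not> val f a"
  by (simp add: neg_fun_def)

lemma neg_fun_neg_fun: "f \<in> \<Omega> \<Longrightarrow> neg_fun (neg_fun f) = f"
  by (rule Omega_eqI) (simp_all add: neg_fun_in_Omega cube_def)

lemma avoids_neg_fun: "avoids (neg_fun f) T x y \<longleftrightarrow> avoids f T (\<not> x) (\<not> y)"
  by (auto simp: avoids_def)

lemma neg_class: "neg (avoiding G) = avoiding (map (\<lambda>(T, x, y). (T, \<not> x, \<not> y)) G)"
proof (intro set_eqI iffI)
  fix f assume "f \<in> avoiding (map (\<lambda>(T, x, y). (T, \<not> x, \<not> y)) G)"
  then have "f \<in> \<Omega>" "neg_fun f \<in> avoiding G"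
    by (auto simp: mem_avoiding_iff neg_fun_in_Omega avoids_neg_fun)
  then show "f \<in> neg (avoiding G)" by (auto simp: neg_def neg_fun_neg_fun intro: image_eqI[of _ _ "neg_fun f"])
next
  fix f assume "f \<in> neg (avoiding G)"
  then show "f \<in> avoiding (map (\<lambda>(T, x, y). (T, \<not> x, \<not> y)) G)"
    by (auto simp: neg_def mem_avoiding_iff neg_fun_in_Omega avoids_neg_fun)
qed

lemma Sminus_class: "\<S>\<^sup>- = avoiding [(r6, True, True)]"
proof (intro set_eqI iffI)
  fix f assume "f \<in> \<S>\<^sup>-"
  then obtain g where "f \<in> \<Omega>" "g \<in> \<S>" "arity g = arity f" "\<forall>a\<in>dom_of f. val f a \<le> val g a"
    by (auto simp: Sminus_def)
  then show "f \<in> avoiding [(r6, True, True)]"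
    by (auto simp: mem_avoiding avoids_iffs \<S>_def)
next
  fix f assume f: "f \<in> avoiding [(r6, True, True)]"
  then have fO: "f \<in> \<Omega>" by (simp add: mem_avoiding)
  \<comment> \<open>Where \<open>f\<close> is 0 at both \<open>a\<close> and its complement, the
    first entry of \<open>a\<close> decides; it exists because the arity is positive, and
    complementing flips it.\<close>
  let ?g = "(arity f, \<lambda>a\<in>dom_of f. val f a \<or> \<not> val f (tuple_compl a) \<and> hd a)"
  have "hd (tuple_compl a) = (\<not> hd a)" if "a \<in> dom_of f" for a
    using that fO by (cases a) (auto simp: tuple_compl_def \<Omega>_def cube_def)
  then have "?g \<in> \<S>"
    using f fO by (auto simp: \<S>_def \<Omega>_def mem_avoiding avoids_iffs)
  then show "f \<in> \<S>\<^sup>-"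
    using fO unfolding Sminus_def by (intro CollectI conjI bexI[of _ ?g]) auto
qed

lemma Splus_class: "\<S>\<^sup>+ = avoiding [(r6, False, False)]"
proof (intro set_eqI iffI)
  fix f assume "f \<in> \<S>\<^sup>+"
  then obtain g where "f \<in> \<Omega>" "g \<in> \<S>" "arity g = arity f" "\<forall>a\<in>dom_of f. val f a \<ge> val g a"
    by (auto simp: Splus_def)
  then show "f \<in> avoiding [(r6, False, False)]"
    by (auto simp: mem_avoiding avoids_iffs \<S>_def)
next
  fix f assume f: "f \<in> avoiding [(r6, False, False)]"
  then have fO: "f \<in> \<Omega>" by (simp add: mem_avoiding)
  \<comment> \<open>Dually, the first entry decides where \<open>f\<close> is 1 at both
    \<open>a\<close> and its complement.\<close>
  let ?g = "(arity f, \<lambda>a\<in>dom_of f. val f a \<and> (val f (tuple_compl a) \<longrightarrow> hd a))"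
  have "hd (tuple_compl a) = (\<not> hd a)" if "a \<in> dom_of f" for a
    using that fO by (cases a) (auto simp: tuple_compl_def \<Omega>_def cube_def)
  then have "?g \<in> \<S>"
    using f fO by (auto simp: \<S>_def \<Omega>_def mem_avoiding avoids_iffs)
  then show "f \<in> \<S>\<^sup>+"
    using fO unfolding Splus_def by (intro CollectI conjI bexI[of _ ?g]) auto
qed

section \<open>Unions with constants, and the table\<close>

text \<open>A forbidden pair of distinct values at \<open>r3\<close> or \<open>rA\<close> compares
  every point with the all-zero or the all-one point: one value at this special point forces the
  function to be constant, which is how adding constants relaxes a prescribed value.\<close>

lemma Un_constants_basic:
  "avoiding [(r1, True, True)] \<union> avoiding [(rF, False, True)] = avoiding [(r3, True, False)]"
  "avoiding [(r1, False, False)] \<union> avoiding [(rF, False, True)] = avoiding [(r3, False, True)]"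
  "avoiding [(r8, True, True)] \<union> avoiding [(rF, False, True)] = avoiding [(rA, False, True)]"
  "avoiding [(r8, False, False)] \<union> avoiding [(rF, False, True)] = avoiding [(rA, True, False)]"
  "avoiding [(r1, True, True), (r8, True, True)] \<union> avoiding [(rF, False, True)] = avoiding [(r3, True, False), (rA, False, True)]"
  "avoiding [(r1, False, False), (r8, False, False)] \<union> avoiding [(rF, False, True)] = avoiding [(r3, False, True), (rA, True, False)]"
  "avoiding [(r1, True, True), (r8, False, False)] \<union> avoiding [(rF, False, True)] = avoiding [(r3, True, False), (rA, True, False)]"
  "avoiding [(r1, False, False), (r8, True, True)] \<union> avoiding [(rF, False, True)] = avoiding [(r3, False, True), (rA, False, True)]"
  "avoiding [(r1, True, True), (r8, False, False)] \<union> avoiding [(rF, True, True)] = avoiding [(r1, True, True), (rA, True, False)]"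
  "avoiding [(r1, False, False), (r8, True, True)] \<union> avoiding [(rF, False, False)] = avoiding [(r1, False, False), (rA, False, True)]"
  "avoiding [(r1, True, True), (r8, False, False)] \<union> avoiding [(rF, False, False)] = avoiding [(r8, False, False), (r3, True, False)]"
  "avoiding [(r1, False, False), (r8, True, True)] \<union> avoiding [(rF, True, True)] = avoiding [(r8, True, True), (r3, False, True)]"
  unfolding set_eq_iff Un_iff mem_avoiding avoids_iffs at0_def at1_def
  by (blast intro: zeros_in_cube ones_in_cube)+

text \<open>Distributivity: the constants obey \<open>G\<close> already, so uniting with them
  affects only the conditions in \<open>H\<close>.\<close>

lemma Un_constants:
  assumes "avoiding H \<union> avoiding D = avoiding H'" "avoiding D \<subseteq> avoiding G"
  shows "avoiding (G @ H) \<union> avoiding D = avoiding (G @ H')"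
  using assms unfolding avoiding_append by blast

text \<open>A constant function produces only one pair of equal values, so it obeys every list that
  does not forbid this pair.\<close>

lemma constants_subset:
  "list_all (\<lambda>(T, x, y). x \<or> y) G \<Longrightarrow> avoiding [(rF, True, True)] \<subseteq> avoiding G"
  "list_all (\<lambda>(T, x, y). \<not> x \<or> \<not> y) G \<Longrightarrow> avoiding [(rF, False, False)] \<subseteq> avoiding G"
  "list_all (\<lambda>(T, x, y). x \<noteq> y) G \<Longrightarrow> avoiding [(rF, False, True)] \<subseteq> avoiding G"
proof -
  have sub: "avoiding D \<subseteq> avoiding G"
    if "\<And>f T x y a b. f \<in> avoiding D \<Longrightarrow> (T, x, y) \<in> set G \<Longrightarrow> a \<in> dom_of f \<Longrightarrow> b \<in> dom_of f
      \<Longrightarrow> \<not> (val f a = x \<and> val f b = y)"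
      "avoiding D \<subseteq> \<Omega>" for D
    using that unfolding mem_avoiding_iff[of _ G] avoids_def subset_iff by fast
  show "list_all (\<lambda>(T, x, y). x \<or> y) G \<Longrightarrow> avoiding [(rF, True, True)] \<subseteq> avoiding G"
    "list_all (\<lambda>(T, x, y). \<not> x \<or> \<not> y) G \<Longrightarrow> avoiding [(rF, False, False)] \<subseteq> avoiding G"
    "list_all (\<lambda>(T, x, y). x \<noteq> y) G \<Longrightarrow> avoiding [(rF, False, True)] \<subseteq> avoiding G"
    by (rule sub; fastforce simp: mem_avoiding avoids_iffs list_all_iff)+
qed

text \<open>The first group adds all constants, the second only the constants 0, the third only the
  constants 1.\<close>

lemmas Un_classes =
  Un_constants_basic(1-8)[THEN Un_constants, OF constants_subset(3)]
  Un_constants_basic(9,12)[THEN Un_constants, OF constants_subset(1)]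
  Un_constants_basic(10,11)[THEN Un_constants, OF constants_subset(2)]

text \<open>Every class expression is rewritten from the inside out into a list of forbidden pairs.
  The lists in \<open>coded_table\<close> keep the order which this rewriting produces, so both
  sides become syntactically equal.\<close>

lemma table_eq: "table = map (\<lambda>(c, G, G1, G2). (avoiding G, avoiding G1, avoiding G2)) coded_table"
  unfolding table_def coded_table_def list.map prod.case
  by (simp only: basic_classes \<S>\<M>_def \<M>\<U>2_def \<M>\<W>2_def Sminus_class Splus_class empty_class
      sub_classes neg_class Int_classes list.map prod.case not_True_eq_False not_False_eq_True
      Un_classes list.pred_inject simp_thms)
    \<comment> \<open>Appends are evaluated only now, since \<open>Un_classes\<close> has to match
      lists of the form \<open>G @ H\<close>.\<close>
    (simp only: append.simps list.map prod.case not_True_eq_False not_False_eq_True)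

theorem theorem5p1:
  shows "{K. stable_class \<J> \<S>\<M> K} = {K. \<exists>C1 C2. (K, C1, C2) \<in> set table}
    \<and> card {K. stable_class \<J> \<S>\<M> K} = 93
    \<and> (\<forall>(K, C1, C2) \<in> set table.
          clone C1 \<and> clone C2 \<and>
          (\<forall>C. clone C \<longrightarrow>
             (K \<cdot> C \<subseteq> K \<longleftrightarrow> C \<subseteq> C1) \<and>
             (C \<cdot> K \<subseteq> K \<longleftrightarrow> C \<subseteq> C2)))"
proof (intro conjI ballI)
  show "{K. stable_class \<J> \<S>\<M> K} = {K. \<exists>C1 C2. (K, C1, C2) \<in> set table}"
  proof -
    have "{K. \<exists>C1 C2. (K, C1, C2) \<in> set table} = fst ` set table" by force
    then show ?thesis by (simp add: stable_classes_coded_table table_eq image_image case_prod_unfold)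
  qed
  show "card {K. stable_class \<J> \<S>\<M> K} = 93"
    by (rule card_stable_classes)
next
  fix row assume "row \<in> set table"
  then obtain c G G1 G2 where row: "(c, G, G1, G2) \<in> set coded_table" "row = (avoiding G, avoiding G1, avoiding G2)"
    by (auto simp: table_eq)
  note classes = coded_table_classes[OF row(1)]
  have v: "consistent (decode c)" using classes(1) by (rule consistent_decode)
  then have "mono (decode c)" by (simp add: consistent_def)
  then show "case row of (K, C1, C2) \<Rightarrow> clone C1 \<and> clone C2 \<and>
      (\<forall>C. clone C \<longrightarrow> (K \<cdot> C \<subseteq> K \<longleftrightarrow> C \<subseteq> C1) \<and> (C \<cdot> K \<subseteq> K \<longleftrightarrow> C \<subseteq> C2))"
    unfolding row(2) prod.case classes(2-4)
    using clone_right clone_left stabilizers[OF v] by blast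
qed

end
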